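(* Let $a>1$ and let $m\ge2$ be an integer. Assume that $\pi/a<\mu<\min\{\pi,2\pi/a\}$. Then there exists $C>0$ depending only on $\mu$, $m$ and $a$ such that $$|K_a^m(x,y)|\le C$$ for all $x,y\in\mathbb{R}^m$ satisfying $\mu\le\left|\arg e^{i(\pm\theta+\pi/a)}\right|\le\pi$ (for both choices of sign), where $\theta\in[0,\pi]$ is the angle between $x$ and $y$, i.e. $\langle x,y\rangle=|x||y|\cos\theta$. In particular, when $a>4$, such an inequality $|K_a^m(x,y)|\le C$ holds for all $x,y\in\mathbb{R}^m$ with $\langle x,y\rangle\le0$.
   Context: For an integer $m\ge2$ put $\lambda=(m-2)/2$. Let $a>0$. For $x,y\in\mathbb{R}^m\setminus\{0\}$ put $z=|x||y|$, $\xi=\langle x,y\rangle/z=\cos\theta$ with $\theta\in[0,\pi]$. For $m\ge3$ the radially deformed Fourier kernel is $$K_a^m(x,y)=a^{2\lambda/a}\,\Gamma\left(\frac{2\lambda+a}{a}\right)\sum_{k=0}^{\infty}e^{-\frac{i\pi k}{a}}\frac{\lambda+k}{\lambda}z^{-\lambda}J_{\frac{2(k+\lambda)}{a}}\left(\frac{2}{a}z^{a/2}\right)C_k^{(\lambda)}(\xi),$$ and for $m=2$ it is the limit $\lambda\to0$ of this expression, namely $$K_a^2(x,y)=J_0(z_a)+2\sum_{k=1}^{\infty}e^{-\frac{i\pi k}{a}}J_{\frac{2k}{a}}(z_a)\cos k\theta,\qquad z_a=\frac2a z^{a/2}.$$ Here $J_\nu$ is the Bessel function of the first kind and $C_k^{(\lambda)}$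 is the Gegenbauer polynomial. If $x=0$ or $y=0$ the kernel is defined by continuity and equals $1$. The argument of a complex number is taken in $(-\pi,\pi]$. *)

theory Defs
  imports "HOL-Analysis.Analysis"
begin

text \<open>
  Bessel function of the first kind of real order \<open>\<nu>\<close>, for arguments \<open>x \<ge> 0\<close>:
  \<open>J\<^sub>\<nu>(x) = (x/2)\<^sup>\<nu> \<Sum>\<^sub>n (-1)\<^sup>n / (n! \<Gamma>(n + \<nu> + 1)) (x/2)\<^sup>2\<^sup>n\<close>.
  The order 0 is separated because \<open>0 powr 0 = 0\<close>, whereas \<open>J\<^sub>0(0) = 1\<close>.
\<close>
definition Bessel_J :: "real \<Rightarrow> real \<Rightarrow> real" where
  "Bessel_J \<nu> x = (if \<nu> = 0 then 1 else (x / 2) powr \<nu>) *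
     (\<Sum>n. (- 1) ^ n / fact n * rGamma (real n + \<nu> + 1) * (x / 2) ^ (2 * n))"

text \<open>
  The Gegenbauer polynomial \<open>C\<^sub>k\<^sup>(\<^sup>l\<^sup>)\<close>, i.e. the coefficient of \<open>t\<^sup>k\<close> in
  \<open>(1 - 2 x t + t\<^sup>2)\<close> to the power \<open>- l\<close>; \<open>pochhammer l (k - j)\<close> is
  \<open>\<Gamma>(k - j + l) / \<Gamma>(l)\<close>.
\<close>
definition Gegenbauer :: "nat \<Rightarrow> real \<Rightarrow> real \<Rightarrow> real" where
  "Gegenbauer k l x =
     (\<Sum>j\<le>k div 2. (- 1) ^ j * pochhammer l (k - j) / (fact j * fact (k - 2 * j)) *
        (2 * x) ^ (k - 2 * j))"

text \<open>
  The radially deformed Fourier kernel on \<open>\<real>\<^sup>m\<close>, \<open>m = CARD('n) \<ge> 2\<close>. The case \<open>m = 2\<close> is the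
  limit \<open>\<lambda> \<rightarrow> 0\<close> of the general expression, and the value 1 at \<open>x = 0\<close> or \<open>y = 0\<close> is the
  continuous extension.
\<close>
definition radial_kernel :: "real \<Rightarrow> real ^ 'n \<Rightarrow> real ^ 'n \<Rightarrow> complex" where
  "radial_kernel a x y =
     (let l = (real CARD('n) - 2) / 2;
          z = norm x * norm y;
          \<xi> = (x \<bullet> y) / z;
          \<theta> = arccos \<xi>;
          za = 2 / a * z powr (a / 2)
      in if x = 0 \<or> y = 0 then 1
         else if CARD('n) = 2 then
           complex_of_real (Bessel_J 0 za) +
           2 * (\<Sum>k. exp (- (\<i> * complex_of_real (pi * real (Suc k) / a))) *
                  complex_of_real (Bessel_J (2 * real (Suc k) / a) za * cos (real (Suc k) * \<theta>)))
         else
           complex_of_real (a powr (2 * l / a) * Gamma ((2 * l + a) / a)) *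
           (\<Sum>k. exp (- (\<i> * complex_of_real (pi * real k / a))) *
              complex_of_real ((l + real k) / l * z powr (- l) *
                Bessel_J (2 * (real k + l) / a) za * Gegenbauer k l \<xi>)))"

end

theory Submission
  imports Defs "HOL-Complex_Analysis.Complex_Analysis"
begin

text \<open>
  The hypothesis with the sign \<open>-\<close> reads \<open>|\<pi>/a - \<theta>| \<ge> \<mu> > \<pi>/a\<close>, hence \<open>\<theta> \<ge> 2\<pi>/a + \<delta>\<close> with
  \<open>\<delta> = \<mu> - \<pi>/a > 0\<close>; for \<open>a > 4\<close> and \<open>x \<bullet> y \<le> 0\<close> the same holds with \<open>\<delta> = \<pi>/2 - 2\<pi>/a\<close>. It remains
  to see why the kernel is bounded for such angles.

  For \<open>\<nu> > 0\<close> and \<open>w > 0\<close> one has \<open>J\<^sub>\<nu>(w) = 1/(2\<pi>i) \<integral> exp (w sinh u - \<nu> u) du\<close>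
  (\<open>Bessel_J_contour_integral\<close>), where the contour comes in along the ray
  \<open>Im u = -\<pi>/2\<close>, follows the imaginary axis from \<open>-i\<pi>/2\<close> to \<open>i\<pi>/2\<close> and leaves along the ray
  \<open>Im u = \<pi>/2\<close>. On this contour \<open>w sinh u\<close> is purely imaginary, so the integrand has modulus
  \<open>exp (- \<nu> Re u)\<close> for every \<open>w\<close>. Inserting this into the series of the kernel, with
  \<open>\<nu> = 2 (k + \<lambda>) / a\<close>, and summing under the integral sign produces the generating function
  \<open>\<Sum>\<^sub>k (\<lambda> + k)/\<lambda> C\<^sub>k(cos \<theta>) t\<^sup>k = (1 - t\<^sup>2) / (1 - 2 t cos \<theta> + t\<^sup>2)\<^sup>\<lambda>\<^sup>+\<^sup>1\<close>
  (\<open>Gegenbauer_generating_function\<close>) at \<open>t = exp (- i\<pi>/a - 2 u / a)\<close>. Along the contour \<open>|t| \<le> 1\<close> and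
  the argument of \<open>t\<close> stays in \<open>[-2\<pi>/a, 0]\<close>, while the singularities are \<open>exp (\<plusminus> i\<theta>)\<close>. For
  \<open>\<theta> \<ge> 2\<pi>/a + \<delta>\<close> they are at a positive distance from all these \<open>t\<close> (\<open>norm_sector_factors\<close>), so the
  generating function is bounded and the series is bounded uniformly in \<open>w\<close>
  (\<open>Bessel_series_bounded\<close>).

  Three supplements complete the proof. The prefactor \<open>z\<^sup>-\<^sup>\<lambda>\<close> is at most 1 for \<open>z \<ge> 1\<close>; for \<open>z \<le> 1\<close> it is
  absorbed termwise by the leading powers of the Bessel functions (\<open>Bessel_J_scaled_small\<close>). In
  dimension 2 the term \<open>J\<^sub>0\<close> is bounded separately through its recurrence, and the remaining series,
  with index shifted by one, is of the same kind with \<open>\<lambda> = 1\<close>. Finally, the contour integral for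
  \<open>J\<^sub>\<nu>\<close> follows from Hankel's formula for \<open>1 / \<Gamma>\<close> (\<open>has_hankel_primitive\<close>) by expanding
  \<open>exp (- (w/2) exp (- u))\<close>; Hankel's formula itself is obtained from Euler's integral and the
  reflection formula when the order lies in \<open>(-1, 0)\<close> and from periodicity when it is 0, and is
  extended to larger orders by integration by parts.
\<close>

section \<open>Hankel's integral for the reciprocal Gamma function\<close>

definition hankel_integrand :: "real \<Rightarrow> complex \<Rightarrow> complex" where
  "hankel_integrand \<mu> u = exp (exp u - of_real \<mu> * u)"

lemma norm_hankel_integrand:
  "norm (hankel_integrand \<mu> (Complex x v)) = exp (exp x * cos v - \<mu> * x)"
  by (simp add: hankel_integrand_def Re_exp)

text \<open>
  On the lines \<open>Im u = \<plusminus>\<pi>\<close> the inner exponential \<open>exp u\<close> is negative, so that the integrand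
  decays doubly exponentially, and its values on the two lines differ by a phase only.
\<close>

lemma hankel_integrand_at_pi:
  assumes "s = 1 \<or> s = -1"
  shows "hankel_integrand \<mu> (Complex x (s * pi)) = of_real (exp (- exp x - \<mu> * x)) * cis (- s * \<mu> * pi)"
proof -
  have "exp (Complex x (s * pi)) = - of_real (exp x)"
    using assms by (auto simp: exp_eq_polar complex_eq_iff)
  moreover have "of_real \<mu> * Complex x (s * pi) = of_real (\<mu> * x) + \<i> * of_real (s * \<mu> * pi)"
    by (simp add: complex_eq_iff)
  ultimately have "hankel_integrand \<mu> (Complex x (s * pi)) =
      exp (of_real (- exp x - \<mu> * x) + \<i> * of_real (- s * \<mu> * pi))"
    by (simp add: hankel_integrand_def algebra_simps)
  also have "\<dots> = of_real (exp (- exp x - \<mu> * x)) * cis (- s * \<mu> * pi)"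
    by (simp only: exp_add exp_of_real cis_conv_exp)
  finally show ?thesis .
qed

lemma entire_primitive:
  fixes f :: "complex \<Rightarrow> complex"
  assumes "f holomorphic_on UNIV"
  obtains F where "\<And>u. (F has_field_derivative f u) (at u)"
  using holomorphic_convex_primitive'[OF convex_UNIV open_UNIV assms] by auto

text \<open>
  Contour integrals of entire functions are treated as increments of a primitive. An integral over
  a vertical segment is then estimated by the mean value inequality.
\<close>

lemma vertical_increment_bound:
  fixes F f :: "complex \<Rightarrow> complex"
  assumes F: "\<And>u. (F has_field_derivative f u) (at u)" and "b \<le> c"
    and B: "\<And>v. b \<le> v \<Longrightarrow> v \<le> c \<Longrightarrow> norm (f (Complex x v)) \<le> B"
  shows "norm (F (Complex x c) - F (Complex x b)) \<le> B * (c - b)"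
proof -
  have "norm (F (Complex x c) - F (Complex x b)) \<le> B * norm (Complex x c - Complex x b)"
  proof (rule field_differentiable_bound[of "closed_segment (Complex x b) (Complex x c)"])
    fix z assume "z \<in> closed_segment (Complex x b) (Complex x c)"
    then obtain v where "z = Complex x v" "b \<le> v" "v \<le> c"
      using \<open>b \<le> c\<close> closed_segment_same_Re[of "Complex x b" "Complex x c"]
      by (auto simp: closed_segment_eq_real_ivl complex_eq_iff)
    then show "norm (f z) \<le> B" using B by simp
  qed (auto intro: has_field_derivative_at_within F)
  also have "Complex x c - Complex x b = \<i> * of_real (c - b)"
    by (simp add: complex_eq_iff)
  finally show ?thesis
    using \<open>b \<le> c\<close> by (simp add: norm_mult del: of_real_diff)
qed

lemma has_vector_derivative_horizontal:
  fixes F f :: "complex \<Rightarrow> complex"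
  assumes "\<And>u. (F has_field_derivative f u) (at u)"
  shows "((\<lambda>x. F (Complex x v)) has_vector_derivative f (Complex x v)) (at x)"
proof -
  have "((\<lambda>x. Complex x v) has_vector_derivative 1) (at x)"
    unfolding Complex_eq by (auto intro!: derivative_eq_intros)
  from field_vector_diff_chain_at[OF this assms]
  show ?thesis by (simp add: o_def)
qed

text \<open>
  Substituting \<open>t = exp x\<close> in Euler's integral turns it into an integral over the whole line; the
  lemma provides its primitive that vanishes at \<open>-\<infinity>\<close>.
\<close>

lemma Gamma_integral_primitive:
  assumes s: "s > (0::real)"
  obtains G where
    "\<And>x. (G has_vector_derivative exp (- exp x + s * x)) (at x)"
    "(G \<longlongrightarrow> 0) at_bot" "(G \<longlongrightarrow> Gamma s) at_top"
proof
  define g where "g = (\<lambda>t::real. t powr (s - 1) / exp t)"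
  define I where "I = (\<lambda>y. integral {0..y} g)"
  have hi: "(g has_integral Gamma s) {0..}"
    unfolding g_def using Gamma_integral_real[OF s] .
  have io: "g integrable_on {0..y}" for y
    by (rule integrable_on_subinterval[of _ "{0..}"]) (use hi in auto)
  have ai: "g absolutely_integrable_on {0..}"
    by (rule nonnegative_absolutely_integrable_1) (use hi in \<open>auto simp: g_def\<close>)
  show "((\<lambda>x. I (exp x)) has_vector_derivative exp (- exp x + s * x)) (at x)" for x
  proof -
    have "(I has_vector_derivative g (exp x)) (at (exp x) within {0..exp x + 1} - {})"
      unfolding I_def
    proof (rule integral_has_vector_derivative_continuous_at)
      have "continuous (at (exp x)) g"
        unfolding g_def by (auto intro!: continuous_intros)
      then show "continuous (at (exp x) within {0..exp x + 1} - {}) g"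
        by (rule continuous_at_imp_continuous_at_within)
    qed (auto simp: io)
    moreover have "at (exp x) within {0..exp x + 1} - {} = at (exp x)"
      by (rule at_within_interior) (auto simp: interior_atLeastAtMost_real)
    ultimately have "(I has_vector_derivative g (exp x)) (at (exp x))"
      by simp
    moreover have "(exp has_vector_derivative exp x) (at x)"
      by (auto intro!: derivative_eq_intros simp: has_real_derivative_iff_has_vector_derivative[symmetric])
    ultimately have "((I \<circ> exp) has_vector_derivative (exp x *\<^sub>R g (exp x))) (at x)"
      by (intro vector_diff_chain_at)
    moreover have "exp x *\<^sub>R g (exp x) = exp (- exp x + s * x)"
      by (simp add: g_def powr_def exp_diff exp_minus exp_add algebra_simps)
    ultimately show ?thesis by (simp add: o_def)
  qed
  show "((\<lambda>x. I (exp x)) \<longlongrightarrow> 0) at_bot"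
  proof -
    have "continuous_on {0..1} I"
      unfolding I_def by (rule indefinite_integral_continuous_1[OF io])
    then have "(I \<longlongrightarrow> I 0) (at 0 within {0..1})"
      by (auto simp: continuous_on_def)
    moreover have "I 0 = 0" by (simp add: I_def)
    moreover have "filterlim (exp :: real \<Rightarrow> real) (at 0 within {0..1}) at_bot"
      unfolding filterlim_at
    proof (intro conjI)
      show "\<forall>\<^sub>F x::real in at_bot. exp x \<in> {0..1} \<and> exp x \<noteq> 0"
        using eventually_le_at_bot[of "0::real"] by eventually_elim auto
    qed (rule exp_at_bot)
    ultimately show ?thesis
      using filterlim_compose[of I "nhds 0" "at 0 within {0..1}" exp at_bot] by simp
  qed
  show "((\<lambda>x. I (exp x)) \<longlongrightarrow> Gamma s) at_top"
  proof -
    have "((\<lambda>b. set_lebesgue_integral lebesgue {0..b} g) \<longlongrightarrow>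
             set_lebesgue_integral lebesgue {0..} g) at_top"
      by (rule tendsto_set_lebesgue_integral_at_top) (use ai in auto)
    moreover have "set_lebesgue_integral lebesgue {0..b} g = I b" for b
      unfolding I_def
      by (rule set_lebesgue_integral_eq_integral(2))
         (rule set_integrable_subset[OF ai], auto)
    moreover have "set_lebesgue_integral lebesgue {0..} g = Gamma s"
      using set_lebesgue_integral_eq_integral(2)[OF ai] hi by (simp add: integral_unique)
    ultimately have "(I \<longlongrightarrow> Gamma s) at_top" by simp
    then show ?thesis by (rule filterlim_compose[OF _ exp_at_top])
  qed
qed

text \<open>
  Hankel's formula: the contour that enters from \<open>\<infinity> - i\<pi>\<close> and leaves to \<open>\<infinity> + i\<pi>\<close> becomes the classical
  loop around the negative axis under \<open>t = exp u\<close>, where the integrand is \<open>t\<^sup>-\<^sup>\<mu>\<^sup>-\<^sup>1 exp t\<close>. Expressing the loop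
  integral as the limit of increments of a primitive leaves the shape of the contour open.
\<close>

definition has_hankel_primitive :: "real \<Rightarrow> bool" where
  "has_hankel_primitive \<mu> \<longleftrightarrow> (\<exists>F.
     (\<forall>u. (F has_field_derivative hankel_integrand \<mu> u) (at u)) \<and>
     ((\<lambda>x. F (Complex x pi) - F (Complex x (- pi))) \<longlongrightarrow>
        2 * of_real pi * \<i> * of_real (rGamma (\<mu> + 1))) at_top)"

lemma holomorphic_hankel_integrand: "hankel_integrand \<mu> holomorphic_on UNIV"
  unfolding hankel_integrand_def by (intro holomorphic_intros)

text \<open>
  For negative \<open>\<mu>\<close> the loop can be shrunk onto the negative axis, that is \<open>x \<rightarrow> -\<infinity>\<close>. The two banks of
  the axis then contribute Euler's integral with opposite phases, and the reflection formula gives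
  \<open>1 / \<Gamma>\<close>.
\<close>

lemma has_hankel_primitive_neg:
  assumes "\<mu> < 0" "\<mu> > -1"
  shows "has_hankel_primitive \<mu>"
proof -
  obtain F where F: "\<And>u. (F has_field_derivative hankel_integrand \<mu> u) (at u)"
    using entire_primitive[OF holomorphic_hankel_integrand] by blast
  obtain G where G: "\<And>x. (G has_vector_derivative exp (- exp x + (-\<mu>) * x)) (at x)"
    "(G \<longlongrightarrow> 0) at_bot" "(G \<longlongrightarrow> Gamma (-\<mu>)) at_top"
    using Gamma_integral_primitive[of "-\<mu>"] assms by auto
  define D where "D = (\<lambda>x. F (Complex x pi) - F (Complex x (- pi)))"
  define K where "K = cis (- (\<mu> * pi)) - cis (\<mu> * pi)"
  have K: "K = - 2 * \<i> * of_real (sin (\<mu> * pi))"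
    by (simp add: K_def complex_eq_iff)
  have "((\<lambda>x. D x - of_real (G x) * K) has_vector_derivative 0) (at x)" for x
  proof -
    have "(D has_vector_derivative
        hankel_integrand \<mu> (Complex x pi) - hankel_integrand \<mu> (Complex x (- pi))) (at x)"
      unfolding D_def by (intro derivative_intros has_vector_derivative_horizontal F)
    also have "hankel_integrand \<mu> (Complex x pi) - hankel_integrand \<mu> (Complex x (- pi)) =
        of_real (exp (- exp x + (-\<mu>) * x)) * K"
      using hankel_integrand_at_pi[of 1 \<mu> x] hankel_integrand_at_pi[of "-1" \<mu> x]
      by (simp add: K_def algebra_simps)
    finally have 1: "(D has_vector_derivative of_real (exp (- exp x + (-\<mu>) * x)) * K) (at x)" .
    have "((\<lambda>x. of_real (G x) * K) has_vector_derivative of_real (exp (- exp x + (-\<mu>) * x)) * K) (at x)"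
      using G(1) by (intro has_vector_derivative_mult_left)
        (auto intro: bounded_linear.has_vector_derivative[OF bounded_linear_of_real])
    from has_vector_derivative_diff[OF 1 this] show ?thesis by simp
  qed
  then obtain c where c: "\<And>x. D x - of_real (G x) * K = c"
    using has_vector_derivative_zero_constant[of UNIV "\<lambda>x. D x - of_real (G x) * K"] by auto
  have "(D \<longlongrightarrow> 0) at_bot"
  proof (rule Lim_null_comparison)
    show "\<forall>\<^sub>F x in at_bot. norm (D x) \<le> exp (1 - \<mu> * x) * (2 * pi)"
      using eventually_le_at_bot[of "0::real"]
    proof eventually_elim
      case (elim x)
      have "norm (D x) \<le> exp (1 - \<mu> * x) * (pi - (-pi))"
        unfolding D_def
      proof (rule vertical_increment_bound[OF F])
        fix v :: real
        have "exp x * cos v \<le> exp x * 1" by (intro mult_left_mono) auto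
        also have "\<dots> \<le> 1" using elim by simp
        finally show "norm (hankel_integrand \<mu> (Complex x v)) \<le> exp (1 - \<mu> * x)"
          by (simp add: norm_hankel_integrand)
      qed auto
      then show ?case by simp
    qed
    have "filterlim (\<lambda>x. 1 - \<mu> * x) at_bot at_bot"
      using assms by real_asymp
    then have "((\<lambda>x. exp (1 - \<mu> * x)) \<longlongrightarrow> 0) at_bot"
      by (rule filterlim_compose[OF exp_at_bot])
    from tendsto_mult_right[OF this, of "2 * pi"]
    show "((\<lambda>x. exp (1 - \<mu> * x) * (2 * pi)) \<longlongrightarrow> 0) at_bot" by simp
  qed
  then have "((\<lambda>x. D x - of_real (G x) * K) \<longlongrightarrow> 0 - of_real 0 * K) at_bot"
    by (intro tendsto_intros G)
  then have "((\<lambda>x::real. c) \<longlongrightarrow> 0) at_bot" by (simp add: c)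
  then have "c = 0"
    by (simp add: tendsto_const_iff)
  then have D: "D x = of_real (G x) * K" for x using c[of x] by simp
  have "(D \<longlongrightarrow> of_real (Gamma (-\<mu>)) * K) at_top"
    unfolding D by (intro tendsto_intros G)
  also have "of_real (Gamma (-\<mu>)) * K = 2 * of_real pi * \<i> * of_real (rGamma (\<mu> + 1))"
  proof -
    have ni: "-\<mu> \<notin> \<int>\<^sub>\<le>\<^sub>0" using assms by (auto elim!: nonpos_Ints_cases)
    have "rGamma (complex_of_real (-\<mu>)) * rGamma (1 - complex_of_real (-\<mu>)) =
        sin (of_real pi * complex_of_real (-\<mu>)) / of_real pi"
      by (rule rGamma_reflection_complex)
    then have "complex_of_real (rGamma (-\<mu>) * rGamma (1 - (-\<mu>))) = of_real (sin (pi * (-\<mu>)) / pi)"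
      by (simp only: rGamma_complex_of_real[symmetric] of_real_mult of_real_divide sin_of_real[symmetric]
            of_real_1 of_real_diff)
    then have "rGamma (-\<mu>) * rGamma (1 - (-\<mu>)) = sin (pi * (-\<mu>)) / pi"
      by (simp only: of_real_eq_iff)
    then have "Gamma (-\<mu>) * (sin (\<mu> * pi)) = - pi * rGamma (\<mu> + 1)"
      using ni by (simp add: Gamma_def field_simps rGamma_eq_zero_iff add.commute)
    then have "complex_of_real (Gamma (-\<mu>)) * of_real (sin (\<mu> * pi)) = - of_real pi * of_real (rGamma (\<mu> + 1))"
      by (metis of_real_mult of_real_minus)
    then show ?thesis by (simp add: K algebra_simps)
  qed
  finally show ?thesis
    unfolding has_hankel_primitive_def D_def using F by blast
qed

text \<open>
  For \<open>\<mu> = 0\<close> the integrand has period \<open>2\<pi>i\<close>, so the increment does not depend on \<open>x\<close>, and it can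
  be read off at \<open>x \<rightarrow> -\<infinity>\<close>, where the integrand tends to 1.
\<close>

lemma has_hankel_primitive_0: "has_hankel_primitive 0"
proof -
  obtain F where F: "\<And>u. (F has_field_derivative hankel_integrand 0 u) (at u)"
    using entire_primitive[OF holomorphic_hankel_integrand] by blast
  define D where "D = (\<lambda>x. F (Complex x pi) - F (Complex x (- pi)))"
  have "(D has_vector_derivative 0) (at x)" for x
  proof -
    have "(D has_vector_derivative
        hankel_integrand 0 (Complex x pi) - hankel_integrand 0 (Complex x (- pi))) (at x)"
      unfolding D_def by (intro derivative_intros has_vector_derivative_horizontal F)
    then show ?thesis
      using hankel_integrand_at_pi[of 1 0 x] hankel_integrand_at_pi[of "-1" 0 x] by simp
  qed
  then obtain c where c: "D = (\<lambda>x. c)"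
    using has_vector_derivative_zero_constant[of UNIV D] by (metis ext UNIV_I convex_UNIV)
  have "((\<lambda>x. D x - 2 * of_real pi * \<i>) \<longlongrightarrow> 0) at_bot"
  proof (rule Lim_null_comparison)
    show "\<forall>\<^sub>F x in at_bot. norm (D x - 2 * of_real pi * \<i>) \<le> (exp (exp x) * exp x) * (2 * pi)"
    proof (intro always_eventually allI)
      fix x :: real
      have "norm ((F (Complex x pi) - Complex x pi) - (F (Complex x (-pi)) - Complex x (-pi)))
          \<le> (exp (exp x) * exp x) * (pi - (-pi))"
      proof (rule vertical_increment_bound[where f = "\<lambda>u. hankel_integrand 0 u - 1"
            and F = "\<lambda>u. F u - u"])
        show "norm (hankel_integrand 0 (Complex x v) - 1) \<le> exp (exp x) * exp x" for v
          using Taylor_exp_field[of "exp (Complex x v)" 0] by (simp add: hankel_integrand_def)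
      qed (auto intro!: derivative_intros F)
      also have "(F (Complex x pi) - Complex x pi) - (F (Complex x (-pi)) - Complex x (-pi)) =
          D x - 2 * of_real pi * \<i>"
        by (simp add: D_def complex_eq_iff)
      finally show "norm (D x - 2 * of_real pi * \<i>) \<le> (exp (exp x) * exp x) * (2 * pi)" by simp
    qed
    have "((\<lambda>x::real. exp (exp x)) \<longlongrightarrow> exp 0) at_bot"
      by (intro tendsto_intros exp_at_bot)
    then have "((\<lambda>x::real. (exp (exp x) * exp x) * (2 * pi)) \<longlongrightarrow> (exp 0 * 0) * (2 * pi)) at_bot"
      by (intro tendsto_intros exp_at_bot)
    then show "((\<lambda>x::real. (exp (exp x) * exp x) * (2 * pi)) \<longlongrightarrow> 0) at_bot" by simp
  qed
  then have "((\<lambda>x::real. c - 2 * of_real pi * \<i>) \<longlongrightarrow> 0) at_bot" by (simp add: c)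
  then have "c = 2 * of_real pi * \<i>"
    by (simp add: tendsto_const_iff)
  then have "(D \<longlongrightarrow> 2 * of_real pi * \<i> * of_real (rGamma (0 + 1))) at_top"
    using \<open>c = _\<close> by (simp add: c)
  then show ?thesis
    unfolding has_hankel_primitive_def D_def using F by blast
qed

text \<open>
  Integration by parts: the derivative of the integrand for \<open>\<mu>\<close> is the integrand for \<open>\<mu> - 1\<close> minus
  \<open>\<mu>\<close> times itself. This mirrors the recurrence of \<open>1 / \<Gamma>\<close>.
\<close>

lemma has_hankel_primitive_step:
  assumes "has_hankel_primitive (\<mu> - 1)" "\<mu> \<noteq> 0"
  shows "has_hankel_primitive \<mu>"
proof -
  from assms(1) obtain F where F: "\<And>u. (F has_field_derivative hankel_integrand (\<mu> - 1) u) (at u)"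
    and lim: "((\<lambda>x. F (Complex x pi) - F (Complex x (- pi))) \<longlongrightarrow>
        2 * of_real pi * \<i> * of_real (rGamma \<mu>)) at_top"
    unfolding has_hankel_primitive_def by auto
  define E where "E = (\<lambda>u. (F u - hankel_integrand \<mu> u) / of_real \<mu>)"
  have "(E has_field_derivative hankel_integrand \<mu> u) (at u)" for u
  proof -
    have "((\<lambda>u. exp (exp u - of_real \<mu> * u)) has_field_derivative
        (exp u - of_real \<mu>) * hankel_integrand \<mu> u) (at u)"
      by (auto intro!: derivative_eq_intros simp: hankel_integrand_def)
    then have "(hankel_integrand \<mu> has_field_derivative
        (exp u - of_real \<mu>) * hankel_integrand \<mu> u) (at u)"
      by (simp add: hankel_integrand_def[abs_def])
    moreover have "hankel_integrand (\<mu> - 1) u = exp u * hankel_integrand \<mu> u"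
      by (simp add: hankel_integrand_def exp_add[symmetric] algebra_simps)
    ultimately show ?thesis
      unfolding E_def using assms(2)
      by (auto intro!: derivative_eq_intros F simp: field_simps)
  qed
  moreover have "((\<lambda>x. E (Complex x pi) - E (Complex x (- pi))) \<longlongrightarrow>
        2 * of_real pi * \<i> * of_real (rGamma (\<mu> + 1))) at_top"
  proof -
    have h0: "((\<lambda>x. hankel_integrand \<mu> (Complex x (s * pi))) \<longlongrightarrow> 0) at_top" if "s = 1 \<or> s = -1" for s
    proof (rule tendsto_norm_zero_cancel)
      have "((\<lambda>x. exp (- exp x - \<mu> * x)) \<longlongrightarrow> 0) at_top"
        by real_asymp
      then show "((\<lambda>x. norm (hankel_integrand \<mu> (Complex x (s * pi)))) \<longlongrightarrow> 0) at_top"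
        using that by (auto simp: norm_hankel_integrand)
    qed
    have "((\<lambda>x. ((F (Complex x pi) - F (Complex x (- pi))) -
        (hankel_integrand \<mu> (Complex x (1 * pi)) - hankel_integrand \<mu> (Complex x ((-1) * pi)))) / of_real \<mu>)
       \<longlongrightarrow> (2 * of_real pi * \<i> * of_real (rGamma \<mu>) - (0 - 0)) / of_real \<mu>) at_top"
      using assms(2) by (intro tendsto_intros lim h0) auto
    moreover have "rGamma \<mu> = \<mu> * rGamma (\<mu> + 1)" by (rule rGamma_plus1[symmetric])
    moreover have "E (Complex x pi) - E (Complex x (- pi)) =
        ((F (Complex x pi) - F (Complex x (- pi))) -
        (hankel_integrand \<mu> (Complex x (1 * pi)) - hankel_integrand \<mu> (Complex x ((-1) * pi)))) / of_real \<mu>" for x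
      by (simp add: E_def diff_divide_distrib add_divide_distrib)
    ultimately show ?thesis
      using assms(2) by (simp add: mult.assoc)
  qed
  ultimately show ?thesis
    unfolding has_hankel_primitive_def by blast
qed

lemma has_hankel_primitive:
  assumes "\<mu> > -1"
  shows "has_hankel_primitive \<mu>"
proof -
  have "has_hankel_primitive (\<mu> + real n)" if "\<mu> > -1" "\<mu> \<le> 0" for n \<mu>
  proof (induction n)
    case 0
    then show ?case using has_hankel_primitive_neg has_hankel_primitive_0 that
      by (cases "\<mu> = 0") auto
  next
    case (Suc n)
    then show ?case using that
      by (intro has_hankel_primitive_step[of "\<mu> + real (Suc n)"]) auto
  qed
  \<comment> \<open>Every \<open>\<mu> > -1\<close> is reached by natural steps from a point of \<open>(-1, 0]\<close>.\<close>
  from this[of "\<mu> - of_int \<lceil>\<mu>\<rceil>" "nat \<lceil>\<mu>\<rceil>"] show ?thesis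
    using assms by simp linarith
qed

text \<open>
  For \<open>\<mu> > 0\<close> the ends of the contour may be lowered to height \<open>\<plusminus>\<pi>/2\<close>: for \<open>\<pi>/2 \<le> |Im u| \<le> \<pi>\<close> the
  cosine is not positive, and the factor \<open>exp (- \<mu> Re u)\<close> alone makes the increment vanish at infinity.
\<close>

lemma hankel_primitive_quarter:
  assumes "\<mu> > 0"
  obtains F where "\<And>u. (F has_field_derivative hankel_integrand \<mu> u) (at u)"
    "((\<lambda>x. F (Complex x (pi/2)) - F (Complex x (- pi/2))) \<longlongrightarrow>
        2 * of_real pi * \<i> * of_real (rGamma (\<mu> + 1))) at_top"
proof -
  obtain F where F: "\<And>u. (F has_field_derivative hankel_integrand \<mu> u) (at u)"
    and lim: "((\<lambda>x. F (Complex x pi) - F (Complex x (- pi))) \<longlongrightarrow>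
        2 * of_real pi * \<i> * of_real (rGamma (\<mu> + 1))) at_top"
    using has_hankel_primitive[of \<mu>] assms unfolding has_hankel_primitive_def by auto
  have e0: "((\<lambda>x. exp (- \<mu> * x)) \<longlongrightarrow> 0) at_top"
    using assms by real_asymp
  have d0: "((\<lambda>x. F (Complex x c) - F (Complex x b)) \<longlongrightarrow> 0) at_top"
    if "b \<le> c" and cos: "\<And>v. b \<le> v \<Longrightarrow> v \<le> c \<Longrightarrow> cos v \<le> 0" for b c
  proof (rule Lim_null_comparison)
    show "\<forall>\<^sub>F x in at_top. norm (F (Complex x c) - F (Complex x b)) \<le> exp (- \<mu> * x) * (c - b)"
    proof (intro always_eventually allI vertical_increment_bound[OF F] that(1))
      fix x v assume "b \<le> v" "v \<le> c"
      then show "norm (hankel_integrand \<mu> (Complex x v)) \<le> exp (- \<mu> * x)"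
        using cos[of v] by (simp add: norm_hankel_integrand mult_nonneg_nonpos)
    qed
    show "((\<lambda>x. exp (- \<mu> * x) * (c - b)) \<longlongrightarrow> 0) at_top"
      by (rule tendsto_mult_left_zero[OF e0])
  qed
  have cos_le_zero: "cos v \<le> 0" if "pi/2 \<le> v" "v \<le> pi" for v
    using cos_monotone_0_pi_le[of "pi/2" v] that by simp
  have "((\<lambda>x. F (Complex x pi) - F (Complex x (pi/2))) \<longlongrightarrow> 0) at_top"
    by (rule d0) (auto intro: cos_le_zero)
  moreover have "((\<lambda>x. F (Complex x (-pi/2)) - F (Complex x (-pi))) \<longlongrightarrow> 0) at_top"
  proof (rule d0)
    fix v assume "- pi \<le> v" "v \<le> - pi / 2"
    then show "cos v \<le> 0" using cos_le_zero[of "-v"] by simp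
  qed auto
  ultimately have "((\<lambda>x. (F (Complex x pi) - F (Complex x (- pi))) -
       (F (Complex x pi) - F (Complex x (pi/2))) - (F (Complex x (-pi/2)) - F (Complex x (-pi)))) \<longlongrightarrow>
      2 * of_real pi * \<i> * of_real (rGamma (\<mu> + 1)) - 0 - 0) at_top"
    by (intro tendsto_diff lim)
  then show ?thesis using that[of F] F by (simp add: algebra_simps)
qed

section \<open>The contour\<close>

text \<open>
  The contour comes in from \<open>\<infinity> - i\<pi>/2\<close>, follows the imaginary axis from \<open>-i\<pi>/2\<close> to \<open>i\<pi>/2\<close> and goes
  out to \<open>\<infinity> + i\<pi>/2\<close>. It is parametrised by arc length over the whole real line, so that an integral
  over it is a single Lebesgue integral, with the velocity \<open>contour_dir\<close> as a factor of modulus 1.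
  At height \<open>\<pi>/2\<close> the function \<open>sinh\<close> is imaginary on the rays as well as on the segment.
\<close>

definition contour_pt :: "real \<Rightarrow> complex" where
  "contour_pt \<tau> = Complex (max 0 (\<bar>\<tau>\<bar> - pi/2)) (max (- pi/2) (min (pi/2) \<tau>))"

definition contour_dir :: "real \<Rightarrow> complex" where
  "contour_dir \<tau> = (if \<bar>\<tau>\<bar> \<le> pi/2 then \<i> else if \<tau> > 0 then 1 else -1)"

lemma norm_contour_dir [simp]: "norm (contour_dir \<tau>) = 1"
  by (simp add: contour_dir_def)

lemma continuous_contour_pt: "continuous_on A contour_pt"
  unfolding contour_pt_def[abs_def] Complex_eq by (intro continuous_intros)

lemma measurable_contour_dir [measurable]: "contour_dir \<in> borel_measurable borel"
  unfolding contour_dir_def[abs_def] by measurable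

lemma measurable_contour_pt:
  assumes "continuous_on UNIV f"
  shows "(\<lambda>\<tau>. f (contour_pt \<tau>)) \<in> borel_measurable borel"
  by (intro borel_measurable_continuous_onI continuous_on_compose2[OF assms continuous_contour_pt]) auto

lemma has_vector_derivative_contour_pt:
  assumes "\<tau> \<noteq> pi/2" "\<tau> \<noteq> -pi/2"
  shows "(contour_pt has_vector_derivative contour_dir \<tau>) (at \<tau>)"
proof -
  consider "\<tau> > pi/2" | "\<tau> < -pi/2" | "\<tau> > -pi/2" "\<tau> < pi/2"
    using assms by linarith
  then show ?thesis
  proof cases
    case 1
    have "((\<lambda>\<tau>. of_real \<tau> - of_real (pi/2) + \<i> * of_real (pi/2)) has_vector_derivative 1) (at \<tau>)"
      by (auto intro!: derivative_eq_intros)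
    then have "(contour_pt has_vector_derivative 1) (at \<tau>)"
      by (rule has_vector_derivative_transform_within_open[where S = "{pi/2<..}"])
         (use 1 pi_gt_zero in \<open>auto simp: contour_pt_def complex_eq_iff max_def min_def abs_if simp del: pi_gt_zero\<close>)
    moreover have "\<tau> > 0" using 1 pi_gt_zero by linarith
    ultimately show ?thesis using 1 by (simp add: contour_dir_def)
  next
    case 2
    have "((\<lambda>\<tau>. - of_real \<tau> - of_real (pi/2) - \<i> * of_real (pi/2)) has_vector_derivative -1) (at \<tau>)"
      by (auto intro!: derivative_eq_intros)
    then have "(contour_pt has_vector_derivative -1) (at \<tau>)"
      by (rule has_vector_derivative_transform_within_open[where S = "{..<-pi/2}"])
         (use 2 pi_gt_zero in \<open>auto simp: contour_pt_def complex_eq_iff max_def min_def abs_if simp del: pi_gt_zero\<close>)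
    moreover have "\<tau> < 0" using 2 pi_gt_zero by linarith
    ultimately show ?thesis using 2 by (simp add: contour_dir_def)
  next
    case 3
    have "((\<lambda>\<tau>. \<i> * of_real \<tau>) has_vector_derivative \<i>) (at \<tau>)"
      by (auto intro!: derivative_eq_intros)
    then have "(contour_pt has_vector_derivative \<i>) (at \<tau>)"
      by (rule has_vector_derivative_transform_within_open[where S = "{-pi/2<..<pi/2}"])
         (use 3 in \<open>auto simp: contour_pt_def complex_eq_iff\<close>)
    then show ?thesis using 3 by (simp add: contour_dir_def)
  qed
qed

lemma has_integral_contour_segment:
  fixes F f :: "complex \<Rightarrow> complex"
  assumes F: "\<And>u. (F has_field_derivative f u) (at u)" and L: "L \<ge> 0"
  shows "((\<lambda>\<tau>. contour_dir \<tau> * f (contour_pt \<tau>)) has_integral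
      (F (Complex L (pi/2)) - F (Complex L (-pi/2)))) {- (L + pi/2)..L + pi/2}"
proof -
  have "((\<lambda>\<tau>. contour_dir \<tau> * f (contour_pt \<tau>)) has_integral
      (F (contour_pt (L + pi/2)) - F (contour_pt (- (L + pi/2))))) {- (L + pi/2)..L + pi/2}"
  proof (rule fundamental_theorem_of_calculus_strong[of "{pi/2, -pi/2}"])
    fix \<tau> assume "\<tau> \<in> {- (L + pi / 2)..L + pi / 2} - {pi / 2, - pi / 2}"
    then show "((\<lambda>\<tau>. F (contour_pt \<tau>)) has_vector_derivative contour_dir \<tau> * f (contour_pt \<tau>)) (at \<tau>)"
      using field_vector_diff_chain_at[OF has_vector_derivative_contour_pt F, of \<tau>]
      by (auto simp: o_def)
  next
    have "continuous_on UNIV F"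
      using F by (meson DERIV_continuous continuous_at_imp_continuous_on)
    then show "continuous_on {- (L + pi / 2)..L + pi / 2} (\<lambda>\<tau>. F (contour_pt \<tau>))"
      by (rule continuous_on_compose2[OF _ continuous_contour_pt]) auto
  qed (use L pi_gt_zero in auto)
  moreover have "contour_pt (L + pi/2) = Complex L (pi/2)" "contour_pt (- (L + pi/2)) = Complex L (-pi/2)"
    using L pi_gt_zero by (auto simp del: pi_gt_zero simp: contour_pt_def max_def min_def abs_if)
  ultimately show ?thesis by simp
qed

text \<open>
  Links the two views of a contour integral: a Lebesgue integral over the parameter, and the limit of
  increments of a primitive between the ends of the truncated contour.
\<close>

lemma contour_integral_eq_limit:
  fixes F f :: "complex \<Rightarrow> complex"
  assumes F: "\<And>u. (F has_field_derivative f u) (at u)"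
    and int: "integrable lborel (\<lambda>\<tau>. contour_dir \<tau> * f (contour_pt \<tau>))"
    and lim: "((\<lambda>x. F (Complex x (pi/2)) - F (Complex x (- pi/2))) \<longlongrightarrow> l) at_top"
  shows "(\<integral>\<tau>. contour_dir \<tau> * f (contour_pt \<tau>) \<partial>lborel) = l"
proof -
  define g where "g = (\<lambda>\<tau>. contour_dir \<tau> * f (contour_pt \<tau>))"
  have g: "integrable lborel g" using int by (simp add: g_def)
  have "(\<lambda>n. \<integral>\<tau>. indicator {- (real n + pi/2)..real n + pi/2} \<tau> *\<^sub>R g \<tau> \<partial>lborel) \<longlonglongrightarrow> (\<integral>\<tau>. g \<tau> \<partial>lborel)"
  proof (rule integral_dominated_convergence[where w = "\<lambda>\<tau>. norm (g \<tau>)"])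
    show "AE \<tau> in lborel. (\<lambda>n. indicator {- (real n + pi/2)..real n + pi/2} \<tau> *\<^sub>R g \<tau>) \<longlonglongrightarrow> g \<tau>"
    proof (intro AE_I2 tendsto_eventually)
      fix \<tau> :: real
      obtain N where "\<bar>\<tau>\<bar> \<le> real N" using real_arch_simple by blast
      then have "\<tau> \<in> {- (real n + pi/2)..real n + pi/2}" if "n \<ge> N" for n
        using that pi_gt_zero of_nat_mono[OF that, where ?'a = real]
        unfolding atLeastAtMost_iff by linarith
      then show "\<forall>\<^sub>F n in sequentially. indicator {- (real n + pi/2)..real n + pi/2} \<tau> *\<^sub>R g \<tau> = g \<tau>"
        by (intro eventually_sequentiallyI[of N]) simp
    qed
  qed (use g in \<open>auto simp: indicator_def\<close>)
  moreover have "(\<integral>\<tau>. indicator {- (real n + pi/2)..real n + pi/2} \<tau> *\<^sub>R g \<tau> \<partial>lborel) =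
      F (Complex n (pi/2)) - F (Complex n (-pi/2))" for n
  proof -
    have "set_integrable lborel {- (real n + pi/2)..real n + pi/2} g"
      unfolding set_integrable_def by (rule integrable_mult_indicator) (use g in auto)
    from set_borel_integral_eq_integral(2)[OF this]
      has_integral_contour_segment[OF F, of "real n"]
    show ?thesis
      by (simp add: set_lebesgue_integral_def g_def integral_unique)
  qed
  ultimately have "(\<lambda>n. F (Complex (real n) (pi/2)) - F (Complex (real n) (-pi/2))) \<longlonglongrightarrow> (\<integral>\<tau>. g \<tau> \<partial>lborel)"
    by simp
  moreover have "(\<lambda>n. F (Complex (real n) (pi/2)) - F (Complex (real n) (-pi/2))) \<longlonglongrightarrow> l"
    by (rule filterlim_compose[OF lim filterlim_real_sequentially])
  ultimately show ?thesis
    unfolding g_def using LIMSEQ_unique by blast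
qed

text \<open>
  The modulus of \<open>exp (- \<nu> u)\<close> along the contour. Up to constants it dominates the
  integrands below; for Bessel functions the constant does not depend on the argument.
\<close>

definition contour_weight :: "real \<Rightarrow> real \<Rightarrow> real" where
  "contour_weight \<nu> \<tau> = exp (- \<nu> * Re (contour_pt \<tau>))"

lemma contour_weight_nonneg [simp]: "contour_weight \<nu> \<tau> \<ge> 0"
  by (simp add: contour_weight_def)

lemma Re_contour_pt_nonneg [simp]: "Re (contour_pt \<tau>) \<ge> 0"
  by (simp add: contour_pt_def)

lemma integrable_contour_weight:
  assumes "\<nu> > 0"
  shows "integrable lborel (contour_weight \<nu>)"
proof -
  define h where "h = (\<lambda>\<tau>::real. indicator {0..} \<tau> * exp (- \<nu> * \<tau>))"
  have "(\<lambda>\<tau>. exp (- \<nu> * \<tau>)) absolutely_integrable_on {0..}"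
    using integrable_on_exp_minus_to_infinity[OF assms, of 0]
    by (intro nonnegative_absolutely_integrable_1) auto
  then have h: "integrable lborel h"
    unfolding h_def set_integrable_def by (subst (asm) integrable_completion) simp_all
  have h2: "integrable lborel (\<lambda>\<tau>. h (- \<tau>))"
    using lborel_integrable_real_affine[OF h, of "-1" 0] by simp
  show ?thesis
  proof (rule Bochner_Integration.integrable_bound)
    \<comment> \<open>The shift by \<open>\<pi>/2\<close> in the parameter costs the factor \<open>exp (\<nu> \<pi> / 2)\<close>.\<close>
    show "integrable lborel (\<lambda>\<tau>. exp (\<nu> * pi / 2) * (h \<tau> + h (- \<tau>)))"
      by (intro integrable_mult_right Bochner_Integration.integrable_add h h2)
    show "contour_weight \<nu> \<in> borel_measurable lborel"
      using measurable_contour_pt[of "\<lambda>u. exp (- \<nu> * Re u)"]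
      by (simp add: contour_weight_def[abs_def] continuous_intros)
    show "AE \<tau> in lborel. norm (contour_weight \<nu> \<tau>) \<le> norm (exp (\<nu> * pi / 2) * (h \<tau> + h (- \<tau>)))"
    proof (rule AE_I2)
      fix \<tau> :: real
      have "contour_weight \<nu> \<tau> \<le> exp (\<nu> * pi / 2) * exp (- \<nu> * \<bar>\<tau>\<bar>)"
        using assms by (auto simp: contour_weight_def contour_pt_def exp_add[symmetric] algebra_simps
            max_def mult_left_mono simp flip: distrib_left)
      also have "exp (- \<nu> * \<bar>\<tau>\<bar>) \<le> h \<tau> + h (- \<tau>)"
        by (auto simp: h_def indicator_def)
      finally show "norm (contour_weight \<nu> \<tau>) \<le> norm (exp (\<nu> * pi / 2) * (h \<tau> + h (- \<tau>)))"
        by (simp add: mult_left_mono abs_mult h_def)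
    qed
  qed
qed

lemma Re_exp_contour_pt: "Re (exp (contour_pt \<tau>)) \<le> 1"
proof (cases "\<bar>\<tau>\<bar> \<le> pi/2")
  case True
  then have "contour_pt \<tau> = Complex 0 \<tau>" by (auto simp: contour_pt_def max_def min_def abs_if split: if_splits)
  then show ?thesis by (simp add: Re_exp)
next
  case False
  then have "Im (contour_pt \<tau>) = pi/2 \<or> Im (contour_pt \<tau>) = - (pi/2)"
    by (auto simp: contour_pt_def max_def min_def abs_if split: if_splits)
  then have "cos (Im (contour_pt \<tau>)) = 0"
    by (elim disjE) (simp_all only: cos_minus cos_pi_half)
  then show ?thesis by (simp add: Re_exp)
qed

text \<open>
  \<open>sinh u\<close> is purely imaginary on the contour. Hence \<open>exp (w sinh u)\<close> has modulus 1 there whatever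
  \<open>w\<close> is, and this is what makes the final bound independent of \<open>|x|\<close> and \<open>|y|\<close>.
\<close>

lemma Re_sinh_contour_pt: "Re (exp (contour_pt \<tau>) - exp (- contour_pt \<tau>)) = 0"
proof (cases "\<bar>\<tau>\<bar> \<le> pi/2")
  case True
  then have "contour_pt \<tau> = Complex 0 \<tau>" by (auto simp: contour_pt_def max_def min_def abs_if split: if_splits)
  then show ?thesis by (simp add: Re_exp)
next
  case False
  then have "Im (contour_pt \<tau>) = pi/2 \<or> Im (contour_pt \<tau>) = - (pi/2)"
    by (auto simp: contour_pt_def max_def min_def abs_if split: if_splits)
  then have "cos (Im (contour_pt \<tau>)) = 0"
    by (elim disjE) (simp_all only: cos_minus cos_pi_half)
  then show ?thesis by (simp add: Re_exp)
qed

text \<open>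
  Hankel's formula on the contour, for \<open>t = r exp u\<close>: the scaling by \<open>r\<close> is a translation of \<open>u\<close> by
  \<open>ln r\<close>, which does not affect limits of increments.
\<close>

lemma Hankel_contour_integral:
  assumes \<mu>: "\<mu> > 0" and r: "r > 0"
  defines "f \<equiv> \<lambda>u. exp (of_real r * exp u - of_real \<mu> * u)"
  shows "integrable lborel (\<lambda>\<tau>. contour_dir \<tau> * f (contour_pt \<tau>))"
    and "(\<integral>\<tau>. contour_dir \<tau> * f (contour_pt \<tau>) \<partial>lborel) =
           2 * of_real pi * \<i> * of_real (r powr \<mu> * rGamma (\<mu> + 1))"
    and "norm (f (contour_pt \<tau>)) \<le> exp r * contour_weight \<mu> \<tau>"
proof -
  show bound: "norm (f (contour_pt \<tau>)) \<le> exp r * contour_weight \<mu> \<tau>" for \<tau>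
  proof -
    have "r * Re (exp (contour_pt \<tau>)) \<le> r * 1"
      using Re_exp_contour_pt r by (intro mult_left_mono) auto
    then show ?thesis
      by (simp add: f_def contour_weight_def exp_add[symmetric])
  qed
  show int: "integrable lborel (\<lambda>\<tau>. contour_dir \<tau> * f (contour_pt \<tau>))"
  proof (rule Bochner_Integration.integrable_bound)
    show "integrable lborel (\<lambda>\<tau>. exp r * contour_weight \<mu> \<tau>)"
      by (intro integrable_mult_right integrable_contour_weight \<mu>)
    show "(\<lambda>\<tau>. contour_dir \<tau> * f (contour_pt \<tau>)) \<in> borel_measurable lborel"
      using measurable_contour_pt[of f]
      by (simp add: f_def continuous_intros)
  qed (use bound in \<open>auto simp: norm_mult abs_mult\<close>)
  obtain F where F: "\<And>u. (F has_field_derivative hankel_integrand \<mu> u) (at u)"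
    and lim: "((\<lambda>x. F (Complex x (pi/2)) - F (Complex x (- pi/2))) \<longlongrightarrow>
        2 * of_real pi * \<i> * of_real (rGamma (\<mu> + 1))) at_top"
    using hankel_primitive_quarter[OF \<mu>] by blast
  define E where "E = (\<lambda>u. of_real (r powr \<mu>) * F (u + of_real (ln r)))"
  show "(\<integral>\<tau>. contour_dir \<tau> * f (contour_pt \<tau>) \<partial>lborel) =
           2 * of_real pi * \<i> * of_real (r powr \<mu> * rGamma (\<mu> + 1))"
  proof (rule contour_integral_eq_limit[OF _ int])
    show "(E has_field_derivative f u) (at u)" for u
    proof -
      have "f u = of_real (r powr \<mu>) * hankel_integrand \<mu> (u + of_real (ln r))"
      proof -
        have "of_real (r powr \<mu>) = exp (of_real \<mu> * of_real (ln r) :: complex)"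
          using r by (simp add: powr_def exp_of_real[symmetric])
        moreover have "exp (of_real (ln r)) = complex_of_real r"
          using r by (simp add: exp_of_real)
        ultimately show ?thesis
          by (simp add: f_def hankel_integrand_def exp_add[symmetric] exp_add[of u] algebra_simps)
      qed
      moreover have "((\<lambda>u. F (u + of_real (ln r))) has_field_derivative hankel_integrand \<mu> (u + of_real (ln r))) (at u)"
        using F DERIV_shift by blast
      ultimately show ?thesis
        unfolding E_def by (auto intro: DERIV_cmult)
    qed
    have "filterlim (\<lambda>x::real. x + ln r) at_top at_top" by real_asymp
    from tendsto_mult_left[OF filterlim_compose[OF lim this], of "of_real (r powr \<mu>)"]
    show "((\<lambda>x. E (Complex x (pi/2)) - E (Complex x (- pi/2))) \<longlongrightarrow>
        2 * of_real pi * \<i> * of_real (r powr \<mu> * rGamma (\<mu> + 1))) at_top"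
      by (simp add: E_def right_diff_distrib Complex_eq algebra_simps)
  qed
qed

section \<open>Bessel functions of the first kind\<close>

text \<open>
  Discarding the part \<open>t < M\<close> of Euler's integral shows that \<open>\<Gamma>(x + 1)\<close> outgrows every \<open>M\<^sup>x\<close>. The free
  parameter \<open>M\<close> serves later to make series of Bessel functions converge faster than any given
  geometric series.
\<close>

lemma rGamma_le_powr_exp:
  assumes x: "x \<ge> 0" and M: "M > (0::real)"
  shows "rGamma (x + 1) \<le> M powr (- x) * exp M"
proof -
  have 1: "((\<lambda>t. M powr x * exp (- t)) has_integral M powr x * exp (- M)) {M..}"
    using has_integral_mult_right[OF has_integral_exp_minus_to_infinity[of 1 M], of "M powr x"] by simp
  have 2: "((\<lambda>t. t powr x / exp t) has_integral Gamma (x + 1)) {0..}"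
    using Gamma_integral_real[of "x + 1"] x by simp
  have 3: "(\<lambda>t. t powr x / exp t) integrable_on {M..}"
  proof -
    have "(\<lambda>t. t powr x / exp t) absolutely_integrable_on {0..}"
      by (rule nonnegative_absolutely_integrable_1) (use 2 in auto)
    then have "(\<lambda>t. t powr x / exp t) absolutely_integrable_on {M..}"
      by (rule set_integrable_subset) (use M in auto)
    then show ?thesis by (simp add: absolutely_integrable_on_def)
  qed
  have "M powr x * exp (- M) \<le> integral {M..} (\<lambda>t. t powr x / exp t)"
    by (rule has_integral_le[OF 1 integrable_integral[OF 3]])
       (use x M in \<open>auto simp: exp_minus field_simps intro!: powr_mono2\<close>)
  also have "\<dots> \<le> Gamma (x + 1)"
    by (rule has_integral_subset_le[OF _ integrable_integral[OF 3] 2]) (use M in auto)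
  finally have "M powr x * exp (- M) \<le> Gamma (x + 1)" .
  then have "inverse (Gamma (x + 1)) \<le> inverse (M powr x * exp (- M))"
    using M by (intro le_imp_inverse_le) auto
  then show ?thesis
    by (simp add: rGamma_inverse_Gamma powr_minus exp_minus)
qed

definition Bessel_coeff :: "real \<Rightarrow> real \<Rightarrow> nat \<Rightarrow> real" where
  "Bessel_coeff \<nu> r n = (- 1) ^ n / fact n * rGamma (real n + \<nu> + 1) * r ^ (2 * n)"

lemma abs_Bessel_coeff_le:
  assumes \<nu>: "\<nu> \<ge> 0" and M: "M \<ge> 1"
  shows "\<bar>Bessel_coeff \<nu> r n\<bar> \<le> M powr (- \<nu>) * exp M * ((r\<^sup>2) ^ n / fact n)"
proof -
  have "rGamma (real n + \<nu> + 1) \<le> M powr (- (real n + \<nu>)) * exp M"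
    using assms by (intro rGamma_le_powr_exp) auto
  also have "\<dots> \<le> M powr (- \<nu>) * exp M"
    using assms by (intro mult_right_mono powr_mono) auto
  finally have "rGamma (real n + \<nu> + 1) * ((r\<^sup>2) ^ n / fact n) \<le>
      (M powr (- \<nu>) * exp M) * ((r\<^sup>2) ^ n / fact n)"
    by (intro mult_right_mono) auto
  moreover have "rGamma (real n + \<nu> + 1) \<ge> 0"
    using Gamma_real_pos[of "real n + \<nu> + 1"] \<nu> by (simp add: rGamma_inverse_Gamma less_imp_le)
  moreover have "\<bar>r ^ (2 * n)\<bar> = (r\<^sup>2) ^ n" by (simp add: power_mult)
  ultimately show ?thesis
    by (simp add: Bessel_coeff_def abs_mult mult_ac)
qed

lemma summable_Bessel_coeff:
  assumes "\<nu> \<ge> 0"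
  shows "summable (Bessel_coeff \<nu> r)"
proof (rule summable_comparison_test)
  show "\<exists>N. \<forall>n\<ge>N. norm (Bessel_coeff \<nu> r n) \<le> 1 powr (- \<nu>) * exp 1 * ((r\<^sup>2) ^ n / fact n)"
    using abs_Bessel_coeff_le[OF assms, of 1 r] by auto
  show "summable (\<lambda>n. 1 powr (- \<nu>) * exp 1 * ((r\<^sup>2) ^ n / fact n))"
    using sums_summable[OF exp_converges[of "r\<^sup>2"]]
    by (intro summable_mult) (simp add: field_simps)
qed

lemma Bessel_J_eq:
  assumes "w > 0"
  shows "Bessel_J \<nu> w = (w / 2) powr \<nu> * suminf (Bessel_coeff \<nu> (w / 2))"
  using assms by (simp add: Bessel_J_def Bessel_coeff_def[abs_def])

lemma Bessel_J_crude_bound: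
  assumes \<nu>: "\<nu> \<ge> 0" and w: "w > 0" and M: "M \<ge> 1"
  shows "\<bar>Bessel_J \<nu> w\<bar> \<le> (w / (2 * M)) powr \<nu> * exp (M + w\<^sup>2 / 4)"
proof -
  define r where "r = w / 2"
  have s: "(\<lambda>n. M powr (- \<nu>) * exp M * ((r\<^sup>2) ^ n / fact n)) sums (M powr (- \<nu>) * exp M * exp (r\<^sup>2))"
    using exp_converges[of "r\<^sup>2"] by (intro sums_mult) (simp add: field_simps)
  have "\<bar>suminf (Bessel_coeff \<nu> r)\<bar> \<le> (\<Sum>n. M powr (- \<nu>) * exp M * ((r\<^sup>2) ^ n / fact n))"
    using norm_suminf_le[of "Bessel_coeff \<nu> r", OF _ sums_summable[OF s]]
      abs_Bessel_coeff_le[OF \<nu> M] by auto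
  also have "\<dots> = M powr (- \<nu>) * exp M * exp (r\<^sup>2)"
    using s by (simp add: sums_iff)
  finally have "\<bar>Bessel_J \<nu> w\<bar> \<le> r powr \<nu> * (M powr (- \<nu>) * exp M * exp (r\<^sup>2))"
    using Bessel_J_eq[OF w] by (simp add: abs_mult r_def mult_left_mono)
  also have "\<dots> = (w / (2 * M)) powr \<nu> * exp (M + w\<^sup>2 / 4)"
  proof -
    have "(w / (2 * M)) powr \<nu> = r powr \<nu> * M powr (- \<nu>)"
      using w M by (simp add: r_def powr_divide powr_mult powr_minus field_simps)
    moreover have "r\<^sup>2 = w\<^sup>2 / 4" by (simp add: r_def power_divide)
    ultimately show ?thesis by (simp only: exp_add mult_ac)
  qed
  finally show ?thesis .
qed

text \<open>
  Schlaefli's representation \<open>J\<^sub>\<nu>(w) = 1/(2\<pi>i) \<integral> exp (w sinh u - \<nu> u) du\<close>. Expanding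
  \<open>exp (- (w/2) exp (- u))\<close> into its power series and integrating term by term reproduces, by Hankel's
  formula with \<open>\<mu> = \<nu> + n\<close>, the defining series of \<open>J\<^sub>\<nu>\<close>. The condition \<open>\<nu> > 0\<close> makes the integral converge
  absolutely.
\<close>

lemma Bessel_J_contour_integral:
  assumes \<nu>: "\<nu> > 0" and w: "w > 0"
  shows "2 * of_real pi * \<i> * of_real (Bessel_J \<nu> w) =
    (\<integral>\<tau>. contour_dir \<tau> * exp (of_real (w/2) * (exp (contour_pt \<tau>) - exp (- contour_pt \<tau>))
        - of_real \<nu> * contour_pt \<tau>) \<partial>lborel)"
proof -
  define r where "r = w / 2"
  have r: "r > 0" using w by (simp add: r_def)
  define f where "f = (\<lambda>\<mu> u. exp (of_real r * exp u - of_real \<mu> * u :: complex))"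
  define g where "g = (\<lambda>n \<tau>. ((- of_real r) ^ n / fact n) *
      (contour_dir \<tau> * f (\<nu> + real n) (contour_pt \<tau>)))"
  have H: "integrable lborel (\<lambda>\<tau>. contour_dir \<tau> * f \<mu> (contour_pt \<tau>))"
      "(\<integral>\<tau>. contour_dir \<tau> * f \<mu> (contour_pt \<tau>) \<partial>lborel) =
           2 * of_real pi * \<i> * of_real (r powr \<mu> * rGamma (\<mu> + 1))"
      "norm (f \<mu> (contour_pt \<tau>)) \<le> exp r * contour_weight \<mu> \<tau>" if "\<mu> > 0" for \<mu> \<tau>
    unfolding f_def by (rule Hankel_contour_integral[OF that r])+
  have int: "integrable lborel (g n)" for n
    unfolding g_def using \<nu> by (intro integrable_mult_right H) auto
  have ng: "norm (g n \<tau>) \<le> (r ^ n / fact n) * (exp r * contour_weight \<nu> \<tau>)" for n \<tau>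
  proof -
    have "norm (f (\<nu> + real n) (contour_pt \<tau>)) \<le> exp r * contour_weight (\<nu> + real n) \<tau>"
      using \<nu> by (intro H) auto
    also have "contour_weight (\<nu> + real n) \<tau> \<le> contour_weight \<nu> \<tau>"
      by (simp add: contour_weight_def algebra_simps)
    finally have "norm (f (\<nu> + real n) (contour_pt \<tau>)) \<le> exp r * contour_weight \<nu> \<tau>" by simp
    then have "(r ^ n / fact n) * norm (f (\<nu> + real n) (contour_pt \<tau>)) \<le> (r ^ n / fact n) * (exp r * contour_weight \<nu> \<tau>)"
      using r by (intro mult_left_mono) auto
    then show ?thesis
      using r by (simp add: g_def norm_mult norm_divide norm_power)
  qed
  have sexp: "summable (\<lambda>n. r ^ n / fact n)"
    using sums_summable[OF exp_converges[of r]] by (simp add: field_simps)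
  have "(\<lambda>n. integral\<^sup>L lborel (g n)) sums (\<integral>\<tau>. (\<Sum>n. g n \<tau>) \<partial>lborel)"
  proof (rule sums_integral[OF int])
    show "AE \<tau> in lborel. summable (\<lambda>n. norm (g n \<tau>))"
      by (intro AE_I2 summable_comparison_test[OF _ summable_mult2[OF sexp]]) (use ng in auto)
    show "summable (\<lambda>n. \<integral>\<tau>. norm (g n \<tau>) \<partial>lborel)"
    proof (rule summable_comparison_test[OF _ summable_mult2[OF sexp, of "\<integral>\<tau>. exp r * contour_weight \<nu> \<tau> \<partial>lborel"]], intro exI allI impI)
      fix n :: nat
      have "(\<integral>\<tau>. norm (g n \<tau>) \<partial>lborel) \<le> (\<integral>\<tau>. (r ^ n / fact n) * (exp r * contour_weight \<nu> \<tau>) \<partial>lborel)"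
        by (intro integral_mono integrable_norm int integrable_mult_right integrable_contour_weight \<nu> ng)
      then show "norm (\<integral>\<tau>. norm (g n \<tau>) \<partial>lborel) \<le> r ^ n / fact n * (\<integral>\<tau>. exp r * contour_weight \<nu> \<tau> \<partial>lborel)"
        by (simp only: integral_mult_right_zero real_norm_def abs_of_nonneg Bochner_Integration.integral_nonneg norm_ge_zero)
    qed
  qed
  also have "(\<lambda>n. integral\<^sup>L lborel (g n)) =
      (\<lambda>n. 2 * of_real pi * \<i> * of_real (r powr \<nu> * Bessel_coeff \<nu> r n))"
  proof
    fix n
    have "integral\<^sup>L lborel (g n) = ((- of_real r) ^ n / fact n) *
        (2 * of_real pi * \<i> * of_real (r powr (\<nu> + real n) * rGamma (\<nu> + real n + 1)))"
      unfolding g_def using \<nu> by (subst integral_mult_right_zero, subst H(2)) auto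
    also have "(- complex_of_real r) ^ n = of_real ((-1)^n * r ^ n)"
      by (simp flip: power_mult_distrib)
    also have "r powr (\<nu> + real n) = r powr \<nu> * r ^ n"
      using r by (simp add: powr_add powr_realpow)
    finally show "integral\<^sup>L lborel (g n) = 2 * of_real pi * \<i> * of_real (r powr \<nu> * Bessel_coeff \<nu> r n)"
      by (simp add: Bessel_coeff_def power2_eq_square power_mult add_ac mult_ac power_mult_distrib)
  qed
  also have "(\<lambda>\<tau>. \<Sum>n. g n \<tau>) = (\<lambda>\<tau>. contour_dir \<tau> * exp (of_real r * (exp (contour_pt \<tau>) - exp (- contour_pt \<tau>))
        - of_real \<nu> * contour_pt \<tau>))"
  proof
    fix \<tau>
    define u where "u = contour_pt \<tau>"
    have e: "g n \<tau> = (contour_dir \<tau> * f \<nu> u) * ((- of_real r * exp (- u)) ^ n /\<^sub>R fact n)" for n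
    proof -
      have "f (\<nu> + real n) u = f \<nu> u * exp (- u) ^ n"
        by (simp add: f_def exp_of_nat_mult[symmetric] exp_add[symmetric] algebra_simps)
      then show ?thesis
        unfolding g_def u_def[symmetric] power_mult_distrib scaleR_conv_of_real
        by (simp add: divide_inverse mult_ac)
    qed
    have "(\<lambda>n. g n \<tau>) sums (contour_dir \<tau> * f \<nu> u * exp (- of_real r * exp (- u)))"
      unfolding e by (intro sums_mult exp_converges)
    then have "(\<Sum>n. g n \<tau>) = contour_dir \<tau> * f \<nu> u * exp (- of_real r * exp (- u))"
      by (simp add: sums_iff)
    also have "\<dots> = contour_dir \<tau> * exp (of_real r * (exp u - exp (- u)) - of_real \<nu> * u)"
      by (simp add: f_def mult.assoc exp_add[symmetric] algebra_simps)
    finally show "(\<Sum>n. g n \<tau>) = contour_dir \<tau> * exp (of_real r * (exp (contour_pt \<tau>) - exp (- contour_pt \<tau>))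
        - of_real \<nu> * contour_pt \<tau>)" by (simp add: u_def)
  qed
  finally have S: "(\<lambda>n. 2 * of_real pi * \<i> * of_real (r powr \<nu> * Bessel_coeff \<nu> r n)) sums
    (\<integral>\<tau>. contour_dir \<tau> * exp (of_real r * (exp (contour_pt \<tau>) - exp (- contour_pt \<tau>))
        - of_real \<nu> * contour_pt \<tau>) \<partial>lborel)" .
  have "(\<lambda>n. r powr \<nu> * Bessel_coeff \<nu> r n) sums Bessel_J \<nu> w"
    unfolding Bessel_J_eq[OF w] r_def using summable_Bessel_coeff[of \<nu> "w/2"] \<nu>
    by (intro sums_mult summable_sums) auto
  then have "(\<lambda>n. 2 * of_real pi * \<i> * complex_of_real (r powr \<nu> * Bessel_coeff \<nu> r n)) sums
      (2 * of_real pi * \<i> * of_real (Bessel_J \<nu> w))"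
    by (intro sums_mult sums_of_real)
  from sums_unique2[OF this S] show ?thesis by (simp add: r_def)
qed

lemma norm_Bessel_contour_integrand:
  "norm (contour_dir \<tau> * exp (of_real x * (exp (contour_pt \<tau>) - exp (- contour_pt \<tau>))
      - of_real \<nu> * contour_pt \<tau>)) = contour_weight \<nu> \<tau>"
proof -
  define d where "d = exp (contour_pt \<tau>) - exp (- contour_pt \<tau>)"
  have "Re d = 0" unfolding d_def by (rule Re_sinh_contour_pt)
  then show ?thesis
    unfolding d_def[symmetric] by (simp add: norm_mult contour_weight_def)
qed

lemma integrable_Bessel_contour_integrand:
  assumes "\<nu> > 0"
  shows "integrable lborel (\<lambda>\<tau>. contour_dir \<tau> * exp (of_real x * (exp (contour_pt \<tau>) - exp (- contour_pt \<tau>))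
      - of_real \<nu> * contour_pt \<tau>))"
proof (rule Bochner_Integration.integrable_bound[OF integrable_contour_weight[OF assms]])
  show "(\<lambda>\<tau>. contour_dir \<tau> * exp (of_real x * (exp (contour_pt \<tau>) - exp (- contour_pt \<tau>))
      - of_real \<nu> * contour_pt \<tau>)) \<in> borel_measurable lborel"
    using measurable_contour_pt[of "\<lambda>u. exp (of_real x * (exp u - exp (- u)) - of_real \<nu> * u)"]
    by (simp add: continuous_intros)
qed (simp add: norm_Bessel_contour_integrand)

lemma Bessel_J_bounded:
  assumes "\<nu> > 0"
  obtains C where "\<And>w. w > 0 \<Longrightarrow> \<bar>Bessel_J \<nu> w\<bar> \<le> C"
proof
  fix w :: real assume w: "w > 0"
  have "norm (2 * of_real pi * \<i> * complex_of_real (Bessel_J \<nu> w)) \<le> (\<integral>\<tau>. contour_weight \<nu> \<tau> \<partial>lborel)"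
    unfolding Bessel_J_contour_integral[OF assms w]
    by (rule order_trans[OF integral_norm_bound]) (simp only: norm_Bessel_contour_integrand order_refl)
  then show "\<bar>Bessel_J \<nu> w\<bar> \<le> (\<integral>\<tau>. contour_weight \<nu> \<tau> \<partial>lborel) / (2 * pi)"
    by (simp add: norm_mult field_simps)
qed

text \<open>
  Order 0 is not covered by the absolutely convergent contour integral; the three-term recurrence
  expresses \<open>J\<^sub>0\<close> by orders for which it is available.
\<close>

lemma Bessel_J_0_recurrence:
  assumes w: "w > 0"
  shows "Bessel_J 0 w = (2 / w) * Bessel_J 1 w - Bessel_J 2 w"
proof -
  define r where "r = w / 2"
  have r: "r > 0" using w by (simp add: r_def)
  note s = summable_Bessel_coeff
  have "suminf (Bessel_coeff 0 r) - suminf (Bessel_coeff 1 r) =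
      (\<Sum>n. Bessel_coeff 0 r n - Bessel_coeff 1 r n)"
    by (intro suminf_diff s) auto
  also have "\<dots> = (\<Sum>n. Bessel_coeff 0 r (Suc n) - Bessel_coeff 1 r (Suc n))"
    by (subst suminf_split_head[OF summable_diff[OF s s]])
       (auto simp: Bessel_coeff_def rGamma_plus1[of 1, simplified])
  also have "\<dots> = (\<Sum>n. (- (r\<^sup>2)) * Bessel_coeff 2 r n)"
  proof (rule suminf_cong)
    fix n
    have 1: "rGamma (real n + 2) = (real n + 2) * rGamma (real n + 3)"
      using rGamma_plus1[of "real n + 2"] by (simp add: add_ac)
    show "Bessel_coeff 0 r (Suc n) - Bessel_coeff 1 r (Suc n) = - (r\<^sup>2) * Bessel_coeff 2 r n"
      by (simp add: Bessel_coeff_def add_ac 1 divide_simps power2_eq_square) (simp add: algebra_simps)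
  qed
  also have "\<dots> = - (r\<^sup>2) * suminf (Bessel_coeff 2 r)"
    by (intro suminf_mult s) auto
  finally show ?thesis
    using w r by (simp add: Bessel_J_eq r_def[symmetric] powr_numeral) (simp add: r_def)
qed

lemma Bessel_J_0_bounded:
  obtains C where "\<And>w. w > 0 \<Longrightarrow> \<bar>Bessel_J 0 w\<bar> \<le> C"
proof -
  obtain C1 where C1: "\<And>w. w > 0 \<Longrightarrow> \<bar>Bessel_J 1 w\<bar> \<le> C1"
    using Bessel_J_bounded[of 1] by auto
  obtain C2 where C2: "\<And>w. w > 0 \<Longrightarrow> \<bar>Bessel_J 2 w\<bar> \<le> C2"
    using Bessel_J_bounded[of 2] by auto
  have C0: "C1 \<ge> 0" "C2 \<ge> 0" using C1[of 1] C2[of 1] by auto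
  have "\<bar>Bessel_J 0 w\<bar> \<le> exp 2 + 2 * C1 + C2" if w: "w > 0" for w
  proof (cases "w \<le> 1")
    case True
    have "\<bar>Bessel_J 0 w\<bar> \<le> exp (1 + w\<^sup>2 / 4)"
      using Bessel_J_crude_bound[of 0 w 1] w by simp
    also have "w\<^sup>2 \<le> 1" using True w by (simp add: power_le_one)
    then have "exp (1 + w\<^sup>2 / 4) \<le> exp 2" by simp
    finally show ?thesis using C0 by simp
  next
    case False
    have "\<bar>Bessel_J 0 w\<bar> \<le> (2 / w) * \<bar>Bessel_J 1 w\<bar> + \<bar>Bessel_J 2 w\<bar>"
      unfolding Bessel_J_0_recurrence[OF w] using w
      using abs_triangle_ineq4[of "2 / w * Bessel_J 1 w" "Bessel_J 2 w"] by (simp add: abs_mult)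
    also have "\<dots> \<le> 2 * C1 + C2"
      using w False C1[OF w] C2[OF w] by (intro add_mono mult_mono) (auto simp: field_simps)
    finally show ?thesis using exp_gt_zero[of "2::real"] by linarith
  qed
  then show ?thesis using that by blast
qed

text \<open>
  Choose \<open>M\<close> in the crude bound so large that \<open>w / (2 M) \<le> q\<^sup>a\<^sup>/\<^sup>2\<close>; increasing \<open>k\<close> by one increases
  the order by \<open>2 / a\<close> and so gains a factor \<open>q\<close>.
\<close>

lemma Bessel_J_superexponential:
  assumes a: "a > 0" and l: "l \<ge> 0" and w: "w > 0" and q: "0 < q"
  obtains C where "\<And>k. \<bar>Bessel_J (2 * (real k + l) / a) w\<bar> \<le> C * q ^ k"
proof -
  define M where "M = max 1 (w / 2 / q powr (a / 2))"
  have M: "M \<ge> 1" by (simp add: M_def)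
  have "w / 2 / q powr (a / 2) \<le> M" by (simp add: M_def)
  then have le: "w / (2 * M) \<le> q powr (a / 2)"
    using M q by (simp add: field_simps)
  show ?thesis
  proof
    fix k
    have "\<bar>Bessel_J (2 * (real k + l) / a) w\<bar> \<le> (w / (2 * M)) powr (2 * (real k + l) / a) * exp (M + w\<^sup>2 / 4)"
      using a l w M by (intro Bessel_J_crude_bound) auto
    also have "\<dots> \<le> (q powr (a / 2)) powr (2 * (real k + l) / a) * exp (M + w\<^sup>2 / 4)"
      using le w M a l by (intro mult_right_mono powr_mono2) auto
    also have "(q powr (a / 2)) powr (2 * (real k + l) / a) = q powr (l + real k)"
    proof -
      have "a / 2 * (2 * (real k + l) / a) = l + real k" using a by simp
      then show ?thesis by (simp only: powr_powr)
    qed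
    also have "\<dots> = q powr l * q ^ k"
      using q by (simp add: powr_add powr_realpow)
    finally show "\<bar>Bessel_J (2 * (real k + l) / a) w\<bar> \<le> (q powr l * exp (M + w\<^sup>2 / 4)) * q ^ k"
      by (simp add: mult_ac)
  qed
qed

section \<open>Series of Bessel functions along a sector\<close>

text \<open>
  Boundedness is required only where \<open>t\<close> has argument in \<open>[-b, 0]\<close>; convergence is required in the
  whole unit disc, and it also controls the growth of the coefficients.
\<close>

definition power_series_bounded_on_sector :: "real \<Rightarrow> (nat \<Rightarrow> complex) \<Rightarrow> real \<Rightarrow> bool" where
  "power_series_bounded_on_sector b g M \<longleftrightarrow> (\<exists>G.
     (\<forall>t. norm t < 1 \<longrightarrow> (\<lambda>k. g k * t ^ k) sums G t) \<and>
     (\<forall>x \<beta>. 0 \<le> x \<and> x < 1 \<and> 0 \<le> \<beta> \<and> \<beta> \<le> b \<longrightarrow> norm (G (of_real x * cis (- \<beta>))) \<le> M))"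

text \<open>
  The core of the argument. Inserting Schlaefli's integral into the series and summing under the
  integral sign gives an integral of \<open>exp (w sinh u - (2 l / a) u) G(t)\<close> with
  \<open>t = exp (- i\<pi>/a - 2 u / a)\<close>. On the contour \<open>|t| \<le> 1\<close> and the argument of \<open>t\<close> lies in \<open>[-2\<pi>/a, 0]\<close>, so
  \<open>|G| \<le> M\<close>, the exponential of \<open>w sinh u\<close> has modulus 1, and \<open>l > 0\<close> makes the rest integrable. On the
  imaginary segment \<open>|t| = 1\<close>, where the power series need not converge; therefore the series is first
  damped by \<open>\<rho>\<^sup>k\<close> with \<open>\<rho> < 1\<close>, the bound is uniform in \<open>\<rho>\<close>, and \<open>\<rho>\<close> is sent to 1.
\<close>

lemma Bessel_series_bounded:
  assumes a: "a > 0" and l: "l > 0"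
  obtains C where
    "\<And>g M w. w > 0 \<Longrightarrow> power_series_bounded_on_sector (2 * pi / a) g M \<Longrightarrow>
      norm (\<Sum>k. exp (- (\<i> * complex_of_real (pi * real k / a))) * g k *
          complex_of_real (Bessel_J (2 * (real k + l) / a) w)) \<le> C * M"
proof -
  define \<nu> where "\<nu> = (\<lambda>k. 2 * (real k + l) / a)"
  have \<nu>: "\<nu> k > 0" for k using a l by (simp add: \<nu>_def)
  define W where "W = (\<integral>\<tau>. contour_weight (\<nu> 0) \<tau> \<partial>lborel)"
  show ?thesis
  proof (rule that[of "W / (2 * pi)"])
    fix g :: "nat \<Rightarrow> complex" and M w
    assume w: "w > (0::real)" and "power_series_bounded_on_sector (2 * pi / a) g M"
    then obtain G where G: "\<And>t. norm t < 1 \<Longrightarrow> (\<lambda>k. g k * t ^ k) sums G t"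
      and M: "\<And>x \<beta>. 0 \<le> x \<Longrightarrow> x < 1 \<Longrightarrow> 0 \<le> \<beta> \<Longrightarrow> \<beta> \<le> 2 * pi / a \<Longrightarrow> norm (G (of_real x * cis (- \<beta>))) \<le> M"
      unfolding power_series_bounded_on_sector_def by blast
    define \<omega> where "\<omega> = exp (- (\<i> * complex_of_real (pi / a)))"
    have \<omega>: "exp (- (\<i> * complex_of_real (pi * real k / a))) = \<omega> ^ k" for k
      unfolding \<omega>_def by (subst exp_of_nat_mult[symmetric]) (simp add: field_simps)
    have norm_\<omega>: "norm \<omega> = 1" by (simp add: \<omega>_def)
    define c where "c = (\<lambda>k. \<omega> ^ k * g k * complex_of_real (Bessel_J (\<nu> k) w))"
    define E where "E = (\<lambda>k \<tau>. contour_dir \<tau> * exp (of_real (w/2) * (exp (contour_pt \<tau>) - exp (- contour_pt \<tau>))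
        - of_real (\<nu> k) * contour_pt \<tau>))"
    have intE: "integrable lborel (E k)" for k
      unfolding E_def by (rule integrable_Bessel_contour_integrand[OF \<nu>])
    have normE: "norm (E k \<tau>) = contour_weight (\<nu> k) \<tau>" for k \<tau>
      unfolding E_def by (rule norm_Bessel_contour_integrand)
    have J: "2 * of_real pi * \<i> * of_real (Bessel_J (\<nu> k) w) = (\<integral>\<tau>. E k \<tau> \<partial>lborel)" for k
      unfolding E_def by (rule Bessel_J_contour_integral[OF \<nu> w])
    have damped: "norm (\<Sum>k. c k * of_real \<rho> ^ k) \<le> W / (2 * pi) * M" if \<rho>: "0 \<le> \<rho>" "\<rho> < 1" for \<rho> :: real
    proof -
      define t where "t = (\<lambda>\<tau>. of_real \<rho> * \<omega> * exp (- of_real (2 / a) * contour_pt \<tau>))"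
      have tpow: "(\<omega> ^ k * g k * of_real \<rho> ^ k) * E k \<tau> = E 0 \<tau> * (g k * t \<tau> ^ k)" for k \<tau>
      proof -
        have "E k \<tau> = E 0 \<tau> * exp (- of_real (2 / a) * contour_pt \<tau>) ^ k"
          unfolding E_def \<nu>_def using a
          by (simp add: exp_of_nat_mult[symmetric] mult.assoc exp_add[symmetric] diff_divide_distrib
              add_divide_distrib algebra_simps)
        then show ?thesis by (simp add: t_def power_mult_distrib mult_ac)
      qed
      have norm_t: "norm (t \<tau>) = \<rho> * exp (- (2 / a * Re (contour_pt \<tau>)))" for \<tau>
        using \<rho> norm_\<omega> by (simp add: t_def norm_mult)
      have norm_t_le: "norm (t \<tau>) \<le> \<rho>" for \<tau>
        unfolding norm_t using \<rho> a by (intro mult_left_le) auto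
      have norm_t_less: "norm (t \<tau>) < 1" for \<tau>
        using norm_t_le[of \<tau>] \<rho> by linarith
      have bG: "norm (G (t \<tau>)) \<le> M" for \<tau>
      proof -
        \<comment> \<open>As \<open>Im u\<close> runs through \<open>[-\<pi>/2, \<pi>/2]\<close>, the phase \<open>\<beta>\<close> runs exactly through \<open>[0, 2\<pi>/a]\<close>.\<close>
        define \<beta> where "\<beta> = pi / a + 2 / a * Im (contour_pt \<tau>)"
        have "Im (contour_pt \<tau>) \<ge> - (pi / 2)" "Im (contour_pt \<tau>) \<le> pi / 2"
          unfolding contour_pt_def using pi_ge_zero by (auto simp only: complex.sel max_def min_def split: if_splits)
        then have \<beta>: "0 \<le> \<beta>" "\<beta> \<le> 2 * pi / a"
          using a by (auto simp: \<beta>_def field_simps)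
        have "\<omega> * exp (- of_real (2 / a) * contour_pt \<tau>) =
            of_real (exp (- (2 / a * Re (contour_pt \<tau>)))) * cis (- \<beta>)"
          unfolding \<omega>_def cis_conv_exp exp_of_real[symmetric] exp_add[symmetric]
          by (rule arg_cong[where f = exp]) (simp add: \<beta>_def complex_eq_iff)
        then have "t \<tau> = of_real (norm (t \<tau>)) * cis (- \<beta>)"
          unfolding norm_t by (simp add: t_def mult.assoc)
        then show ?thesis
          using M[OF norm_ge_zero norm_t_less \<beta>] by metis
      qed
      have sg: "summable (\<lambda>k. norm (g k * of_real \<rho> ^ k))"
        by (rule powser_insidea[of g "of_real ((1 + \<rho>) / 2)"])
           (use \<rho> G[of "of_real ((1 + \<rho>) / 2)"] in \<open>auto simp: sums_iff simp del: of_real_add of_real_divide\<close>)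
      define f where "f = (\<lambda>k \<tau>. E 0 \<tau> * (g k * t \<tau> ^ k))"
      have intf: "integrable lborel (f k)" for k
        unfolding f_def tpow[symmetric] by (intro integrable_mult_right intE)
      have nf: "norm (f k \<tau>) \<le> norm (g k * of_real \<rho> ^ k) * contour_weight (\<nu> 0) \<tau>" for k \<tau>
      proof -
        have "norm (g k) * norm (t \<tau>) ^ k \<le> norm (g k) * \<rho> ^ k"
          by (intro mult_left_mono power_mono norm_t_le) auto
        then have "contour_weight (\<nu> 0) \<tau> * (norm (g k) * norm (t \<tau>) ^ k) \<le> contour_weight (\<nu> 0) \<tau> * (norm (g k) * \<rho> ^ k)"
          by (rule mult_left_mono) simp
        also have "\<dots> = norm (g k * of_real \<rho> ^ k) * contour_weight (\<nu> 0) \<tau>"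
          using \<rho> by (simp add: norm_mult norm_power)
        finally show ?thesis
          by (simp only: f_def norm_mult normE norm_power)
      qed
      have a1: "AE \<tau> in lborel. summable (\<lambda>k. norm (f k \<tau>))"
        by (intro AE_I2 summable_comparison_test[OF _ summable_mult2[OF sg]]) (use nf in auto)
      have a2: "summable (\<lambda>k. \<integral>\<tau>. norm (f k \<tau>) \<partial>lborel)"
      proof (rule summable_comparison_test[OF _ summable_mult2[OF sg, of W]], intro exI allI impI)
        fix k :: nat
        have "(\<integral>\<tau>. norm (f k \<tau>) \<partial>lborel) \<le> (\<integral>\<tau>. norm (g k * of_real \<rho> ^ k) * contour_weight (\<nu> 0) \<tau> \<partial>lborel)"
          by (intro integral_mono integrable_norm intf integrable_mult_right integrable_contour_weight \<nu> nf)
        then show "norm (\<integral>\<tau>. norm (f k \<tau>) \<partial>lborel) \<le> norm (g k * of_real \<rho> ^ k) * W"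
          by (simp only: W_def integral_mult_right_zero real_norm_def abs_of_nonneg Bochner_Integration.integral_nonneg norm_ge_zero)
      qed
      have fsum: "(\<Sum>k. f k \<tau>) = E 0 \<tau> * G (t \<tau>)" for \<tau>
        unfolding f_def using sums_mult[OF G[OF norm_t_less[of \<tau>]], of "E 0 \<tau>"] by (simp add: sums_iff)
      have "(\<lambda>k. integral\<^sup>L lborel (f k)) sums (\<integral>\<tau>. E 0 \<tau> * G (t \<tau>) \<partial>lborel)"
        using sums_integral[OF intf a1 a2] by (simp add: fsum)
      moreover have "integral\<^sup>L lborel (f k) = 2 * of_real pi * \<i> * (c k * of_real \<rho> ^ k)" for k
      proof -
        have "integral\<^sup>L lborel (f k) = (\<omega> ^ k * g k * of_real \<rho> ^ k) * (\<integral>\<tau>. E k \<tau> \<partial>lborel)"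
          unfolding f_def tpow[symmetric] by (rule integral_mult_right_zero)
        then show ?thesis unfolding J[symmetric] by (simp add: c_def mult_ac)
      qed
      ultimately have S: "(\<lambda>k. 2 * of_real pi * \<i> * (c k * of_real \<rho> ^ k)) sums (\<integral>\<tau>. E 0 \<tau> * G (t \<tau>) \<partial>lborel)"
        by simp
      have "(\<lambda>k. (2 * of_real pi * \<i> * (c k * of_real \<rho> ^ k)) / (2 * of_real pi * \<i>)) sums
          ((\<integral>\<tau>. E 0 \<tau> * G (t \<tau>) \<partial>lborel) / (2 * of_real pi * \<i>))"
        by (rule sums_divide[OF S])
      then have eq: "(\<Sum>k. c k * of_real \<rho> ^ k) = (\<integral>\<tau>. E 0 \<tau> * G (t \<tau>) \<partial>lborel) / (2 * of_real pi * \<i>)"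
        by (simp add: sums_iff)
      have "norm (\<integral>\<tau>. E 0 \<tau> * G (t \<tau>) \<partial>lborel) \<le> (\<integral>\<tau>. norm (E 0 \<tau> * G (t \<tau>)) \<partial>lborel)"
        by (rule integral_norm_bound)
      also have "\<dots> \<le> (\<integral>\<tau>. contour_weight (\<nu> 0) \<tau> * M \<partial>lborel)"
      proof (intro integral_mono integrable_norm integrable_mult_left integrable_contour_weight \<nu>)
        show "integrable lborel (\<lambda>\<tau>. E 0 \<tau> * G (t \<tau>))"
          using integrable_suminf[OF intf a1 a2] by (simp add: fsum)
        show "norm (E 0 \<tau> * G (t \<tau>)) \<le> contour_weight (\<nu> 0) \<tau> * M" for \<tau>
          by (simp add: norm_mult normE mult_left_mono bG)
      qed
      also have "\<dots> = W * M" by (simp add: W_def)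
      finally show ?thesis
        unfolding eq by (simp add: norm_divide norm_mult divide_right_mono)
    qed
    \<comment> \<open>Any radius of convergence above 1 gives continuity at 1; the coefficients \<open>g k\<close> grow at most like
      \<open>2\<^sup>k\<close>, which the decay of the Bessel functions outweighs.\<close>
    have sc: "summable (\<lambda>k. c k * 2 ^ k)"
    proof -
      have "summable (\<lambda>k. g k * (1/2) ^ k)" using G[of "1/2"] by (auto simp: sums_iff)
      then have "Bseq (\<lambda>k. g k * (1/2) ^ k)"
        by (meson summable_LIMSEQ_zero convergent_imp_Bseq convergentI)
      then obtain B where B: "\<And>k. norm (g k * (1/2) ^ k) \<le> B" by (auto simp: Bseq_def)
      then have gB: "norm (g k) \<le> B * 2 ^ k" for k
        using B[of k] by (simp add: norm_mult norm_power norm_divide power_divide field_simps)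
      obtain D where D: "\<And>k. \<bar>Bessel_J (2 * (real k + l) / a) w\<bar> \<le> D * (1/8) ^ k"
        using Bessel_J_superexponential[OF a less_imp_le[OF l] w, of "1/8"] by auto
      have "norm (c k * 2 ^ k) \<le> B * D * (1/2) ^ k" for k
      proof -
        have "norm (c k * 2 ^ k) = norm (g k) * \<bar>Bessel_J (\<nu> k) w\<bar> * 2 ^ k"
          by (simp add: c_def norm_mult norm_power norm_\<omega>)
        also have "\<dots> \<le> (B * 2 ^ k) * (D * (1/8) ^ k) * 2 ^ k"
          using gB[of k] D[of k] by (intro mult_right_mono mult_mono) (auto simp: \<nu>_def intro: order_trans[OF norm_ge_zero])
        also have "\<dots> = B * D * (2 * (1/8) * 2) ^ k"
          unfolding power_mult_distrib by simp
        finally show ?thesis by simp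
      qed
      then show ?thesis
        by (intro summable_comparison_test[OF _ summable_mult[OF summable_geometric[of "1/2"]]]) auto
    qed
    have "(\<lambda>n. \<Sum>k. c k * of_real (1 - inverse (real (Suc n))) ^ k) \<longlonglongrightarrow> (\<Sum>k. c k * of_real 1 ^ k)"
    proof (rule isCont_tendsto_compose[where g = "\<lambda>x. \<Sum>k. c k * x ^ k"])
      show "isCont (\<lambda>x. \<Sum>k. c k * x ^ k) (of_real 1)"
        by (rule isCont_powser[OF sc]) auto
      have "(\<lambda>n. 1 - inverse (real (Suc n))) \<longlonglongrightarrow> 1 - 0"
        by (intro tendsto_intros LIMSEQ_inverse_real_of_nat)
      then show "(\<lambda>n. complex_of_real (1 - inverse (real (Suc n)))) \<longlonglongrightarrow> of_real 1"
        by (intro tendsto_of_real) simp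
    qed
    then have "(\<lambda>n. norm (\<Sum>k. c k * of_real (1 - inverse (real (Suc n))) ^ k)) \<longlonglongrightarrow> norm (\<Sum>k. c k * of_real 1 ^ k)"
      by (rule tendsto_norm)
    then have "norm (\<Sum>k. c k * of_real 1 ^ k) \<le> W / (2 * pi) * M"
      by (rule LIMSEQ_le_const2) (intro exI allI impI damped, auto simp: field_simps)
    then show "norm (\<Sum>k. exp (- (\<i> * complex_of_real (pi * real k / a))) * g k *
          complex_of_real (Bessel_J (2 * (real k + l) / a) w)) \<le> W / (2 * pi) * M"
      by (simp only: \<omega> c_def \<nu>_def of_real_1 power_one mult_1_right)
  qed
qed

section \<open>Gegenbauer polynomials and their generating function\<close>

text \<open>
  By the law of cosines the squared distance is at least \<open>1 - 2 x cos \<delta> + x\<^sup>2 = (x - cos \<delta>)\<^sup>2 + sin\<^sup>2 \<delta>\<close>: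
  geometrically, \<open>sin \<delta>\<close> bounds from below the distance from 1 to the sector with
  directions at angle at least \<open>\<delta>\<close> from the positive axis.
\<close>

lemma norm_one_minus_sector:
  assumes d: "0 < \<delta>" "\<delta> < pi" and x: "0 \<le> x" and \<phi>: "\<delta> \<le> \<phi>" "\<phi> \<le> 2 * pi - \<delta>"
  shows "norm (1 - of_real x * cis \<phi>) \<ge> sin \<delta>"
proof -
  have "cos \<phi> \<le> cos \<delta>"
  proof (cases "\<phi> \<le> pi")
    case True
    then show ?thesis using d \<phi> by (intro cos_monotone_0_pi_le) auto
  next
    case False
    have "cos \<phi> = cos (2 * pi - \<phi>)" by (simp add: cos_diff)
    also have "\<dots> \<le> cos \<delta>"
      using d \<phi> False by (intro cos_monotone_0_pi_le) auto
    finally show ?thesis .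
  qed
  have "(norm (1 - of_real x * cis \<phi>))\<^sup>2 = (1 - x * cos \<phi>)\<^sup>2 + (x * sin \<phi>)\<^sup>2"
    by (simp add: cmod_power2)
  also have "\<dots> = 1 - 2 * x * cos \<phi> + x\<^sup>2 * ((sin \<phi>)\<^sup>2 + (cos \<phi>)\<^sup>2)"
    unfolding power2_eq_square by (simp only: algebra_simps)
  also have "\<dots> \<ge> 1 - 2 * x * cos \<delta> + x\<^sup>2"
    using \<open>cos \<phi> \<le> cos \<delta>\<close> x by (simp add: mult_left_mono)
  moreover have "1 - 2 * x * cos \<delta> + x\<^sup>2 = (x - cos \<delta>)\<^sup>2 + (sin \<delta>)\<^sup>2"
    by (simp add: sin_squared_eq power2_eq_square algebra_simps)
  ultimately have "(sin \<delta>)\<^sup>2 \<le> (norm (1 - of_real x * cis \<phi>))\<^sup>2"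
    using zero_le_power2[of "x - cos \<delta>"] by linarith
  then show ?thesis by (rule power2_le_imp_le) simp
qed

text \<open>
  The base \<open>1 - 2 t cos \<theta> + t\<^sup>2\<close> of the generating function, written as 1 plus a polynomial without
  constant term, as the binomial series needs it.
\<close>

definition Gegenbauer_denom :: "real \<Rightarrow> complex \<Rightarrow> complex" where
  "Gegenbauer_denom \<theta> t = 1 + (t\<^sup>2 - 2 * of_real (cos \<theta>) * t)"

lemma Gegenbauer_denom_factor:
  "Gegenbauer_denom \<theta> t = (1 - t * cis \<theta>) * (1 - t * cis (- \<theta>))"
proof -
  have "cis \<theta> * cis (- \<theta>) = 1" by (simp add: cis_mult)
  moreover have "cis \<theta> + cis (- \<theta>) = 2 * of_real (cos \<theta>)" by (simp add: complex_eq_iff)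
  moreover have "(1 - t * cis \<theta>) * (1 - t * cis (- \<theta>)) =
      1 + (t\<^sup>2 * (cis \<theta> * cis (- \<theta>)) - (cis \<theta> + cis (- \<theta>)) * t)"
    by (simp only: power2_eq_square ring_distribs) (simp only: algebra_simps mult_1_left mult_1_right)
  ultimately show ?thesis
    by (simp only: Gegenbauer_denom_def mult_1_right)
qed

lemma norm_Gegenbauer_denom_ge:
  assumes "norm t < 1"
  shows "norm (Gegenbauer_denom \<theta> t) \<ge> (1 - norm t)\<^sup>2"
proof -
  have "norm (1 - t * cis \<phi>) \<ge> 1 - norm t" for \<phi>
    using norm_triangle_ineq2[of 1 "t * cis \<phi>"] by (simp add: norm_mult)
  then have "norm (1 - t * cis \<theta>) * norm (1 - t * cis (- \<theta>)) \<ge> (1 - norm t) * (1 - norm t)"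
    using assms by (intro mult_mono) auto
  then show ?thesis by (simp add: Gegenbauer_denom_factor norm_mult power2_eq_square)
qed

text \<open>
  In the unit disc both factors have positive real part, hence arguments in \<open>(-\<pi>/2, \<pi>/2)\<close>, and the
  product avoids the branch cut of the principal power.
\<close>

lemma Gegenbauer_denom_not_nonpos:
  assumes "norm t < 1"
  shows "Gegenbauer_denom \<theta> t \<notin> \<real>\<^sub>\<le>\<^sub>0"
proof
  assume "Gegenbauer_denom \<theta> t \<in> \<real>\<^sub>\<le>\<^sub>0"
  then obtain s where s: "Gegenbauer_denom \<theta> t = of_real s" "s \<le> 0"
    by (elim nonpos_Reals_cases)
  define u where "u = 1 - t * cis \<theta>"
  define v where "v = 1 - t * cis (- \<theta>)"
  have pos: "Re (1 - t * cis \<phi>) > 0" for \<phi>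
    using complex_Re_le_cmod[of "t * cis \<phi>"] assms by (simp add: norm_mult del: Re_complex_of_real times_complex.sel)
  have uv: "u * v = of_real s" using s by (simp add: u_def v_def Gegenbauer_denom_factor)
  have "Re v * (norm u)\<^sup>2 = Re (v * (u * cnj u))"
    by (simp add: complex_norm_square[symmetric] del: of_real_power)
  also have "v * (u * cnj u) = (u * v) * cnj u" by (simp add: mult_ac)
  also have "Re \<dots> = s * Re u" by (simp add: uv)
  also have "\<dots> \<le> 0" using s pos[of \<theta>] by (simp add: u_def mult_nonpos_nonneg del: minus_complex.sel)
  finally have "Re v * (norm u)\<^sup>2 \<le> 0" .
  moreover have "Re u > 0" "Re v > 0" unfolding u_def v_def by (rule pos)+
  moreover from this have "(norm u)\<^sup>2 > 0" by auto
  ultimately show False by (simp add: mult_le_0_iff)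
qed

lemma fps_nth_X_minus_const_power:
  "((fps_X - fps_const c) ^ i) $ m = (if m \<le> i then of_nat (i choose m) * (- c) ^ (i - m) else (0::'a::field_char_0))"
proof -
  have "(fps_X - fps_const c) ^ i = (fps_X + fps_const (- c)) ^ i"
    by (simp add: fps_const_neg[symmetric] del: fps_const_neg)
  also have "\<dots> = (\<Sum>k\<le>i. of_nat (i choose k) * fps_X ^ k * fps_const (- c) ^ (i - k))"
    by (rule binomial_ring)
  also have "\<dots> = (\<Sum>k\<le>i. fps_const (of_nat (i choose k) * (- c) ^ (i - k)) * fps_X ^ k)"
    by (intro sum.cong refl) (simp add: fps_const_power fps_of_nat[symmetric] mult_ac)
  also have "\<dots> $ m = (\<Sum>k\<le>i. if k = m then of_nat (i choose k) * (- c) ^ (i - k) else 0)"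
    unfolding fps_sum_nth by (intro sum.cong refl) auto
  also have "\<dots> = (if m \<le> i then of_nat (i choose m) * (- c) ^ (i - m) else 0)"
    by (simp add: sum.delta')
  finally show ?thesis .
qed

text \<open>
  With \<open>c = 2 \<xi>\<close>, the \<open>i\<close>-th power of \<open>t\<^sup>2 - c t\<close> is \<open>t\<^sup>i (t - c)\<^sup>i\<close> and contributes to \<open>t\<^sup>k\<close> only for \<open>i = k - j\<close>
  with \<open>2 j \<le> k\<close>; this reindexing yields the explicit sum that defines the polynomial.
\<close>

lemma fps_nth_Gegenbauer:
  "(fps_binomial (- of_real l) oo (fps_X\<^sup>2 - fps_const (2 * of_real \<xi>) * fps_X)) $ k =
     complex_of_real (Gegenbauer k l \<xi>)"
proof -
  define c :: complex where "c = 2 * of_real \<xi>"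
  have Z: "(fps_X\<^sup>2 - fps_const c * fps_X) ^ i = fps_X ^ i * (fps_X - fps_const c) ^ i" for i
    by (subst power_mult_distrib[symmetric]) (simp add: power2_eq_square algebra_simps)
  have "(fps_binomial (- of_real l) oo (fps_X\<^sup>2 - fps_const c * fps_X)) $ k =
      (\<Sum>i=0..k. (- of_real l gchoose i) * (fps_X ^ i * (fps_X - fps_const c) ^ i) $ k)"
    by (simp only: fps_compose_nth fps_binomial_nth Z)
  also have "\<dots> = (\<Sum>i=0..k. (- of_real l gchoose i) *
       (if k - i \<le> i then of_nat (i choose (k - i)) * (- c) ^ (2 * i - k) else 0))"
    by (intro sum.cong refl) (auto simp: fps_X_power_mult_nth fps_nth_X_minus_const_power mult_2)
  also have "\<dots> = (\<Sum>j=0..k. (- of_real l gchoose (k - j)) *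
       (if j \<le> k - j then of_nat ((k - j) choose j) * (- c) ^ (2 * (k - j) - k) else 0))"
    by (rule sum.reindex_bij_witness[of _ "\<lambda>j. k - j" "\<lambda>j. k - j"]) auto
  also have "\<dots> = (\<Sum>j\<le>k div 2. (- of_real l gchoose (k - j)) *
       (of_nat ((k - j) choose j) * (- c) ^ (2 * (k - j) - k)))"
    by (rule sum.mono_neutral_cong_right) auto
  also have "\<dots> = (\<Sum>j\<le>k div 2. complex_of_real ((- 1) ^ j * pochhammer l (k - j) / (fact j * fact (k - 2 * j)) *
        (2 * \<xi>) ^ (k - 2 * j)))"
  proof (intro sum.cong refl)
    fix j assume "j \<in> {..k div 2}"
    then have j: "2 * j \<le> k" by auto
    have e: "2 * (k - j) - k = k - 2 * j" "k - j - j = k - 2 * j" using j by auto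
    have sign: "(-1) ^ (k - j) * (-1) ^ (k - 2 * j) = ((-1) ^ j :: complex)"
    proof -
      have "(-1) ^ (k - j) * (-1) ^ (k - 2 * j) = ((-1) ^ ((k - j) + (k - 2 * j)) :: complex)"
        by (rule power_add[symmetric])
      also have "(k - j) + (k - 2 * j) = j + 2 * (k - 2 * j)" using j by auto
      finally show ?thesis by (simp add: power_add power_mult)
    qed
    have binom: "(of_nat ((k - j) choose j) :: complex) = fact (k - j) / (fact j * fact (k - 2 * j))"
      using binomial_fact[of j "k - j", where 'a = complex] j e by simp
    have gbinom: "(- of_real l :: complex) gchoose (k - j) = (-1) ^ (k - j) * of_real (pochhammer l (k - j)) / fact (k - j)"
      by (simp add: gbinomial_pochhammer pochhammer_of_real)
    have c: "(- c) ^ (k - 2 * j) = (-1) ^ (k - 2 * j) * of_real ((2 * \<xi>) ^ (k - 2 * j))"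
      by (subst power_minus) (simp add: c_def)
    have "(- of_real l gchoose (k - j)) * (of_nat ((k - j) choose j) * (- c) ^ (2 * (k - j) - k)) =
        ((-1) ^ (k - j) * (-1) ^ (k - 2 * j)) * of_real (pochhammer l (k - j)) / (fact j * fact (k - 2 * j)) *
        complex_of_real ((2 * \<xi>) ^ (k - 2 * j))"
      unfolding binom gbinom c e by (simp add: divide_simps)
    then show "(- of_real l gchoose (k - j)) * (of_nat ((k - j) choose j) * (- c) ^ (2 * (k - j) - k)) =
        complex_of_real ((- 1) ^ j * pochhammer l (k - j) / (fact j * fact (k - 2 * j)) * (2 * \<xi>) ^ (k - 2 * j))"
      unfolding sign by simp
  qed
  finally show ?thesis by (simp add: Gegenbauer_def c_def)
qed

text \<open>
  The function \<open>F(t) = (1 - 2 t cos \<theta> + t\<^sup>2)\<^sup>-\<^sup>l\<close> is holomorphic in the unit disc, so its Taylor series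
  with coefficients \<open>C\<^sub>k\<close> converges there, and so does that of \<open>l F + t F'\<close>, which has the coefficients
  \<open>(l + k) C\<^sub>k\<close> and simplifies to the stated closed form.
\<close>

lemma Gegenbauer_generating_function:
  assumes t: "norm t < 1"
  shows "(\<lambda>k. complex_of_real ((l + real k) * Gegenbauer k l (cos \<theta>)) * t ^ k) sums
      (of_real l * (1 - t\<^sup>2) * Gegenbauer_denom \<theta> t powr (- of_real l - 1))"
proof -
  define Z where "Z = (\<lambda>t::complex. t\<^sup>2 - 2 * of_real (cos \<theta>) * t)"
  define P where "P = (fps_X\<^sup>2 - fps_const (2 * of_real (cos \<theta>)) * fps_X :: complex fps)"
  define B where "B = fps_binomial (- complex_of_real l) oo P"
  define F where "F = (\<lambda>t. Gegenbauer_denom \<theta> t powr (- of_real l))"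
  have ZP: "Z has_fps_expansion P"
    unfolding Z_def P_def by (intro fps_expansion_intros)
  have "((\<lambda>x. (1 + x) powr (- of_real l)) \<circ> Z) has_fps_expansion B"
    unfolding B_def by (intro has_fps_expansion_compose has_fps_expansion_binomial_complex ZP) (simp add: P_def)
  then have FB: "F has_fps_expansion B"
    by (simp add: F_def Gegenbauer_denom_def Z_def o_def)
  have dF: "(F has_field_derivative (- of_real l * (2 * t - 2 * of_real (cos \<theta>)) *
      Gegenbauer_denom \<theta> t powr (- of_real l - 1))) (at t)" if "norm t < 1" for t
    unfolding F_def using Gegenbauer_denom_not_nonpos[OF that, of \<theta>]
    unfolding Gegenbauer_denom_def
    by (auto intro!: derivative_eq_intros simp: algebra_simps)
  have holF: "F holomorphic_on ball 0 1"
  proof (rule holomorphic_onI)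
    fix t :: complex assume "t \<in> ball 0 1"
    then have "norm t < 1" by simp
    from dF[OF this] show "F field_differentiable at t within ball 0 1"
      using field_differentiable_at_within field_differentiable_def by blast
  qed
  define H where "H = (\<lambda>t. of_real l * F t + t * deriv F t)"
  have "H has_fps_expansion (fps_const (of_real l) * B + fps_X * fps_deriv B)"
    unfolding H_def by (intro fps_expansion_intros FB)
  moreover have "H holomorphic_on eball 0 (ereal 1)"
    unfolding H_def using holF by (simp, intro holomorphic_intros) auto
  ultimately have "(\<lambda>n. fps_nth (fps_const (of_real l) * B + fps_X * fps_deriv B) n * t ^ n) sums H t"
    by (rule has_fps_expansion_imp_sums_complex) (use t in auto)
  also have "(\<lambda>n. fps_nth (fps_const (of_real l) * B + fps_X * fps_deriv B) n * t ^ n) =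
      (\<lambda>k. complex_of_real ((l + real k) * Gegenbauer k l (cos \<theta>)) * t ^ k)"
  proof
    fix k
    have "B $ k = complex_of_real (Gegenbauer k l (cos \<theta>))"
      unfolding B_def P_def by (rule fps_nth_Gegenbauer)
    then show "fps_nth (fps_const (of_real l) * B + fps_X * fps_deriv B) k * t ^ k =
      complex_of_real ((l + real k) * Gegenbauer k l (cos \<theta>)) * t ^ k"
      by (cases k) (simp_all add: algebra_simps)
  qed
  also have "H t = of_real l * (1 - t\<^sup>2) * Gegenbauer_denom \<theta> t powr (- of_real l - 1)"
  proof -
    define d where "d = Gegenbauer_denom \<theta> t"
    have "d \<noteq> 0" using Gegenbauer_denom_not_nonpos[OF t, of \<theta>] by (auto simp: d_def)
    then have "F t = d * d powr (- of_real l - 1)"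
      by (simp add: F_def d_def[symmetric] powr_diff)
    moreover have "deriv F t = - of_real l * (2 * t - 2 * of_real (cos \<theta>)) * d powr (- of_real l - 1)"
      unfolding d_def by (rule DERIV_imp_deriv[OF dF[OF t]])
    ultimately have "H t = of_real l * (d - t * (2 * t - 2 * of_real (cos \<theta>))) * d powr (- of_real l - 1)"
      by (simp only: H_def) (simp add: algebra_simps)
    also have "d - t * (2 * t - 2 * of_real (cos \<theta>)) = 1 - t\<^sup>2"
      by (simp add: d_def Gegenbauer_denom_def power2_eq_square algebra_simps)
    finally show ?thesis by (simp add: d_def)
  qed
  finally show ?thesis .
qed

section \<open>Boundedness of the kernel\<close>

text \<open>
  Cauchy's estimate on the circle of radius \<open>1 / 2\<close>.
\<close>

lemma power_series_coeff_le:
  fixes g :: "nat \<Rightarrow> complex"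
  assumes G: "\<And>t. norm t < 1 \<Longrightarrow> (\<lambda>k. g k * t ^ k) sums G t"
    and B: "\<And>t. norm t = 1 / 2 \<Longrightarrow> norm (G t) \<le> B"
  shows "norm (g k) \<le> B * 2 ^ k"
proof -
  have hol: "G holomorphic_on ball 0 1"
    by (rule power_series_holomorphic[where a = g]) (use G in auto)
  have "G has_fps_expansion Abs_fps g"
  proof (rule has_fps_expansionI)
    have "\<forall>\<^sub>F t in nhds 0. t \<in> ball (0 :: complex) 1"
      by (rule eventually_nhds_in_open) auto
    then show "\<forall>\<^sub>F t in nhds 0. (\<lambda>n. fps_nth (Abs_fps g) n * t ^ n) sums G t"
      by eventually_elim (use G in auto)
  qed
  then have "g k = (deriv ^^ k) G 0 / fact k"
    using fps_nth_fps_expansion[of G "Abs_fps g" k] by simp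
  moreover have "norm ((deriv ^^ k) G 0) \<le> fact k * B / (1/2) ^ k"
  proof (rule Cauchy_inequality)
    show "G holomorphic_on ball 0 (1/2)"
      by (rule holomorphic_on_subset[OF hol]) auto
    show "continuous_on (cball 0 (1/2)) G"
      by (rule continuous_on_subset[OF holomorphic_on_imp_continuous_on[OF hol]]) auto
  qed (use B in auto)
  then have "norm ((deriv ^^ k) G 0) / fact k \<le> B * 2 ^ k"
    by (simp add: power_divide field_simps)
  ultimately show ?thesis by (simp add: norm_divide)
qed

text \<open>
  This is where the restriction on the angle enters: the singularities of the generating function are
  \<open>exp (\<plusminus> i\<theta>)\<close>, and \<open>\<theta> \<ge> 2\<pi>/a + \<delta>\<close> keeps both of them, the second one after a turn by \<open>2\<pi>\<close>, at
  angular distance at least \<open>\<delta>\<close> from every \<open>t\<close> with argument in \<open>[-2\<pi>/a, 0]\<close>.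
\<close>

lemma norm_sector_factors:
  assumes \<delta>: "0 < \<delta>" "\<delta> < pi" and \<theta>: "2 * pi / a + \<delta> \<le> \<theta>" "\<theta> \<le> pi"
    and \<beta>: "0 \<le> \<beta>" "\<beta> \<le> 2 * pi / a" and x: "0 \<le> x"
  shows "norm (1 - of_real x * cis (- \<beta>) * cis \<theta>) \<ge> sin \<delta>"
    and "norm (1 - of_real x * cis (- \<beta>) * cis (- \<theta>)) \<ge> sin \<delta>"
proof -
  have "norm (1 - of_real x * cis (\<theta> - \<beta>)) \<ge> sin \<delta>"
    using \<theta> \<beta> \<delta> by (intro norm_one_minus_sector x) auto
  then show "norm (1 - of_real x * cis (- \<beta>) * cis \<theta>) \<ge> sin \<delta>"
    by (simp add: mult.assoc cis_mult)
  have "norm (1 - of_real x * cis (\<theta> + \<beta>)) \<ge> sin \<delta>"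
    using \<theta> \<beta> \<delta> by (intro norm_one_minus_sector x) auto
  also have "norm (1 - of_real x * cis (\<theta> + \<beta>)) = norm (cnj (1 - of_real x * cis (\<theta> + \<beta>)))"
    by (simp only: complex_mod_cnj)
  finally show "norm (1 - of_real x * cis (- \<beta>) * cis (- \<theta>)) \<ge> sin \<delta>"
    by (simp add: mult.assoc cis_mult cis_cnj add.commute)
qed

lemma norm_Gegenbauer_generating_le:
  assumes D: "norm (Gegenbauer_denom \<theta> t) \<ge> c" "c > 0" and l: "l \<ge> 0" and t: "norm t \<le> 1"
  shows "norm ((1 - t\<^sup>2) * Gegenbauer_denom \<theta> t powr (- of_real l - 1)) \<le> 2 * c powr (- l - 1)"
proof -
  have "norm (1 - t\<^sup>2) \<le> 1 + norm (t\<^sup>2)"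
    using norm_triangle_ineq4[of 1 "t\<^sup>2"] by simp
  also have "\<dots> \<le> 2" using t by (simp add: norm_power power_le_one)
  finally have 1: "norm (1 - t\<^sup>2) \<le> 2" .
  have "norm (Gegenbauer_denom \<theta> t powr (- of_real l - 1)) = norm (Gegenbauer_denom \<theta> t) powr (- l - 1)"
    by (subst norm_powr_real_powr') auto
  also have "\<dots> \<le> c powr (- l - 1)"
    using D l by (intro powr_mono2') auto
  finally show ?thesis
    unfolding norm_mult using 1 by (intro mult_mono) auto
qed

text \<open>
  For \<open>m = 2\<close> the terms with \<open>k \<ge> 1\<close> have the orders \<open>2 (k + 1) / a\<close> after a shift of the index, so the
  general bound for series of Bessel functions applies with \<open>l = 1\<close>. The generating function of
  \<open>cos ((k + 1) \<theta>)\<close> is a sum of two geometric series.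
\<close>

lemma planar_series_bounded:
  assumes a: "a > 0" and \<delta>: "0 < \<delta>" "\<delta> < pi"
  obtains C where "\<And>w \<theta>. w > 0 \<Longrightarrow> 2 * pi / a + \<delta> \<le> \<theta> \<Longrightarrow> \<theta> \<le> pi \<Longrightarrow>
     norm (\<Sum>k. exp (- (\<i> * complex_of_real (pi * real (Suc k) / a))) *
        complex_of_real (Bessel_J (2 * real (Suc k) / a) w * cos (real (Suc k) * \<theta>))) \<le> C"
proof -
  obtain C where C: "\<And>g M w. w > 0 \<Longrightarrow> power_series_bounded_on_sector (2 * pi / a) g M \<Longrightarrow>
      norm (\<Sum>k. exp (- (\<i> * complex_of_real (pi * real k / a))) * g k *
          complex_of_real (Bessel_J (2 * (real k + 1) / a) w)) \<le> C * M"
    using Bessel_series_bounded[OF a zero_less_one] by blast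
  show ?thesis
  proof (rule that[of "C * (1 / sin \<delta>)"])
    fix w \<theta> :: real
    assume w: "w > 0" and \<theta>: "2 * pi / a + \<delta> \<le> \<theta>" "\<theta> \<le> pi"
    define e where "e = exp (- (\<i> * complex_of_real (pi / a)))"
    define g where "g = (\<lambda>k. e * complex_of_real (cos (real (Suc k) * \<theta>)))"
    define G where "G = (\<lambda>t. e * ((cis \<theta> * (1 / (1 - t * cis \<theta>)) + cis (- \<theta>) * (1 / (1 - t * cis (- \<theta>)))) / 2))"
    have s: "sin \<delta> > 0" using \<delta> by (rule sin_gt_zero)
    have eq: "exp (- (\<i> * complex_of_real (pi * real (Suc k) / a))) *
        complex_of_real (Bessel_J (2 * real (Suc k) / a) w * cos (real (Suc k) * \<theta>)) =
        exp (- (\<i> * complex_of_real (pi * real k / a))) * g k *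
          complex_of_real (Bessel_J (2 * (real k + 1) / a) w)" for k
    proof -
      have "exp (- (\<i> * complex_of_real (pi * real (Suc k) / a))) =
          exp (- (\<i> * complex_of_real (pi * real k / a))) * e"
        unfolding e_def exp_add[symmetric] by (simp add: add_divide_distrib algebra_simps)
      moreover have "real (Suc k) = real k + 1" by simp
      ultimately show ?thesis by (simp only: g_def of_real_mult mult_ac)
    qed
    have "norm (\<Sum>k. exp (- (\<i> * complex_of_real (pi * real k / a))) * g k *
          complex_of_real (Bessel_J (2 * (real k + 1) / a) w)) \<le> C * (1 / sin \<delta>)"
    proof (rule C[OF w], unfold power_series_bounded_on_sector_def, intro exI[of _ G] conjI allI impI)
      fix t :: complex assume t: "norm t < 1"
      have "(\<lambda>k. (t * cis \<phi>) ^ k) sums (1 / (1 - t * cis \<phi>))" for \<phi>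
        using t by (intro geometric_sums) (simp add: norm_mult)
      then have "(\<lambda>k. e * ((cis \<theta> * (t * cis \<theta>) ^ k + cis (- \<theta>) * (t * cis (- \<theta>)) ^ k) / 2)) sums G t"
        unfolding G_def by (intro sums_mult sums_divide sums_add)
      moreover have "e * ((cis \<theta> * (t * cis \<theta>) ^ k + cis (- \<theta>) * (t * cis (- \<theta>)) ^ k) / 2) = g k * t ^ k" for k
      proof -
        have p: "cis \<phi> * (t * cis \<phi>) ^ k = cis (real (Suc k) * \<phi>) * t ^ k" for \<phi>
        proof -
          have "cis (real (Suc k) * \<phi>) = cis \<phi> * cis \<phi> ^ k"
            using Complex.DeMoivre[of \<phi> "Suc k"] by (simp only: power_Suc)
          then show ?thesis by (simp only: power_mult_distrib mult_ac)
        qed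
        have "cis (real (Suc k) * \<theta>) + cis (real (Suc k) * (- \<theta>)) = 2 * of_real (cos (real (Suc k) * \<theta>))"
          by (simp add: complex_eq_iff)
        then show ?thesis
          unfolding p g_def distrib_right[symmetric] by simp
      qed
      ultimately show "(\<lambda>k. g k * t ^ k) sums G t" by simp
    next
      fix x \<beta> :: real assume "0 \<le> x \<and> x < 1 \<and> 0 \<le> \<beta> \<and> \<beta> \<le> 2 * pi / a"
      then have x: "0 \<le> x" "x < 1" and \<beta>: "0 \<le> \<beta>" "\<beta> \<le> 2 * pi / a" by auto
      define t where "t = complex_of_real x * cis (- \<beta>)"
      note f = norm_sector_factors[OF \<delta> \<theta> \<beta> x(1), folded t_def]
      have "norm (cis \<theta> * (1 / (1 - t * cis \<theta>)) + cis (- \<theta>) * (1 / (1 - t * cis (- \<theta>)))) \<le>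
          1 / sin \<delta> + 1 / sin \<delta>"
        by (rule order_trans[OF norm_triangle_ineq add_mono])
           (use f s in \<open>auto simp: norm_mult norm_divide intro!: divide_left_mono mult_pos_pos\<close>)
      then show "norm (G t) \<le> 1 / sin \<delta>"
        by (simp add: G_def norm_mult norm_divide e_def)
    qed
    then show "norm (\<Sum>k. exp (- (\<i> * complex_of_real (pi * real (Suc k) / a))) *
        complex_of_real (Bessel_J (2 * real (Suc k) / a) w * cos (real (Suc k) * \<theta>))) \<le> C * (1 / sin \<delta>)"
      unfolding eq .
  qed
qed

lemma Gegenbauer_series_bounded_large:
  assumes a: "a > 0" and \<delta>: "0 < \<delta>" "\<delta> < pi" and l: "l > 0"
  obtains C where "\<And>w z \<theta>. w > 0 \<Longrightarrow> z \<ge> 1 \<Longrightarrow> 2 * pi / a + \<delta> \<le> \<theta> \<Longrightarrow> \<theta> \<le> pi \<Longrightarrow>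
     norm (\<Sum>k. exp (- (\<i> * complex_of_real (pi * real k / a))) *
        complex_of_real ((l + real k) / l * z powr (- l) *
           Bessel_J (2 * (real k + l) / a) w * Gegenbauer k l (cos \<theta>))) \<le> C"
proof -
  obtain C where C: "\<And>g M w. w > 0 \<Longrightarrow> power_series_bounded_on_sector (2 * pi / a) g M \<Longrightarrow>
      norm (\<Sum>k. exp (- (\<i> * complex_of_real (pi * real k / a))) * g k *
          complex_of_real (Bessel_J (2 * (real k + l) / a) w)) \<le> C * M"
    using Bessel_series_bounded[OF a l] by blast
  define M where "M = 2 * ((sin \<delta>)\<^sup>2) powr (- l - 1)"
  show ?thesis
  proof (rule that[of "C * M"])
    fix w z \<theta> :: real
    assume w: "w > 0" and z: "z \<ge> 1" and \<theta>: "2 * pi / a + \<delta> \<le> \<theta>" "\<theta> \<le> pi"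
    define g where "g = (\<lambda>k. complex_of_real (z powr (- l) / l) *
        complex_of_real ((l + real k) * Gegenbauer k l (cos \<theta>)))"
    define G where "G = (\<lambda>t. complex_of_real (z powr (- l)) *
        ((1 - t\<^sup>2) * Gegenbauer_denom \<theta> t powr (- of_real l - 1)))"
    have s: "sin \<delta> > 0" using \<delta> by (rule sin_gt_zero)
    have eq: "exp (- (\<i> * complex_of_real (pi * real k / a))) *
        complex_of_real ((l + real k) / l * z powr (- l) *
           Bessel_J (2 * (real k + l) / a) w * Gegenbauer k l (cos \<theta>)) =
        exp (- (\<i> * complex_of_real (pi * real k / a))) * g k *
          complex_of_real (Bessel_J (2 * (real k + l) / a) w)" for k
      by (simp add: g_def mult_ac)
    have "norm (\<Sum>k. exp (- (\<i> * complex_of_real (pi * real k / a))) * g k *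
          complex_of_real (Bessel_J (2 * (real k + l) / a) w)) \<le> C * M"
    proof (rule C[OF w], unfold power_series_bounded_on_sector_def, intro exI[of _ G] conjI allI impI)
      fix t :: complex assume "norm t < 1"
      from sums_mult[OF Gegenbauer_generating_function[OF this, of l \<theta>], of "complex_of_real (z powr (- l) / l)"]
      show "(\<lambda>k. g k * t ^ k) sums G t"
        using l by (simp add: g_def G_def mult.assoc)
    next
      fix x \<beta> :: real assume "0 \<le> x \<and> x < 1 \<and> 0 \<le> \<beta> \<and> \<beta> \<le> 2 * pi / a"
      then have x: "0 \<le> x" "x < 1" and \<beta>: "0 \<le> \<beta>" "\<beta> \<le> 2 * pi / a" by auto
      define t where "t = complex_of_real x * cis (- \<beta>)"
      note f = norm_sector_factors[OF \<delta> \<theta> \<beta> x(1), folded t_def]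
      have "(sin \<delta>)\<^sup>2 \<le> norm (Gegenbauer_denom \<theta> t)"
        unfolding Gegenbauer_denom_factor norm_mult power2_eq_square
        by (rule mult_mono) (use f s in auto)
      then have "norm ((1 - t\<^sup>2) * Gegenbauer_denom \<theta> t powr (- of_real l - 1)) \<le> M"
        unfolding M_def by (rule norm_Gegenbauer_generating_le) (use s l x in \<open>auto simp: t_def norm_mult\<close>)
      moreover have "z powr (- l) \<le> 1"
        using z l powr_mono[of "- l" 0 z] by simp
      ultimately have "z powr (- l) * norm ((1 - t\<^sup>2) * Gegenbauer_denom \<theta> t powr (- of_real l - 1)) \<le> 1 * M"
        by (intro mult_mono) auto
      then show "norm (G t) \<le> M"
        by (simp add: G_def norm_mult)
    qed
    then show "norm (\<Sum>k. exp (- (\<i> * complex_of_real (pi * real k / a))) *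
        complex_of_real ((l + real k) / l * z powr (- l) *
           Bessel_J (2 * (real k + l) / a) w * Gegenbauer k l (cos \<theta>))) \<le> C * M"
      unfolding eq .
  qed
qed

text \<open>
  For small \<open>z\<close> the factor \<open>z\<^sup>-\<^sup>l\<close> is compensated by the leading power of the Bessel function: with
  \<open>w = (2 / a) z\<^sup>a\<^sup>/\<^sup>2\<close> and order \<open>2 (k + l) / a\<close> that power is a multiple of \<open>z\<^sup>k\<^sup>+\<^sup>l\<close>.
\<close>

lemma Bessel_J_scaled_small:
  assumes a: "a > 0" and l: "l \<ge> 0"
  obtains C where "\<And>k z. 0 < z \<Longrightarrow> z \<le> 1 \<Longrightarrow>
    z powr (- l) * \<bar>Bessel_J (2 * (real k + l) / a) (2 / a * z powr (a / 2))\<bar> \<le> C * (1 / 4) ^ k"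
proof -
  \<comment> \<open>The crude bound yields the factor \<open>(a M)\<^sup>-\<^sup>\<nu>\<close> with \<open>\<nu> = 2 (k + l) / a\<close>, which is at most \<open>4\<^sup>-\<^sup>k\<close>
    once \<open>a M \<ge> 4\<^sup>a\<^sup>/\<^sup>2\<close>.\<close>
  define M where "M = max 1 (4 powr (a / 2) / a)"
  have M: "M \<ge> 1" by (simp add: M_def)
  have "4 powr (a / 2) / a \<le> M" by (simp add: M_def)
  then have aM: "4 powr (a / 2) \<le> a * M" using a by (simp add: field_simps)
  show ?thesis
  proof (rule that)
    fix k :: nat and z :: real assume z: "0 < z" "z \<le> 1"
    define w where "w = 2 / a * z powr (a / 2)"
    have w: "w > 0" using a z by (simp add: w_def)
    have "w \<le> 2 / a"
      using a z powr_le1[of "a / 2" z] by (simp add: w_def field_simps)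
    then have w2: "w\<^sup>2 \<le> (2 / a)\<^sup>2" using w by (intro power_mono) auto
    define \<nu> where "\<nu> = 2 * (real k + l) / a"
    have \<nu>: "\<nu> \<ge> 0" using a l by (simp add: \<nu>_def)
    have a\<nu>: "a / 2 * \<nu> = real k + l" using a by (simp add: \<nu>_def)
    have "(w / (2 * M)) powr \<nu> = (z powr (a / 2) / (a * M)) powr \<nu>"
      using a by (simp add: w_def)
    also have "\<dots> = z powr (real k + l) / (a * M) powr \<nu>"
      using a z M by (simp only: powr_divide powr_powr a\<nu>)
    also have "\<dots> \<le> z powr (real k + l) / (4 powr (a / 2)) powr \<nu>"
      using a z M \<nu> aM by (intro divide_left_mono powr_mono2 mult_pos_pos) auto
    also have "\<dots> = z powr (real k + l) / 4 powr (real k + l)"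
      by (simp only: powr_powr a\<nu>)
    also have "\<dots> \<le> z powr l / 4 powr (real k)"
      using z l by (intro frac_le powr_mono powr_mono') auto
    finally have p: "(w / (2 * M)) powr \<nu> \<le> z powr l * (1 / 4) ^ k"
      by (simp add: powr_realpow power_divide)
    have "\<bar>Bessel_J \<nu> w\<bar> \<le> (w / (2 * M)) powr \<nu> * exp (M + w\<^sup>2 / 4)"
      using \<nu> w M by (rule Bessel_J_crude_bound)
    also have "\<dots> \<le> (z powr l * (1 / 4) ^ k) * exp (M + (2 / a)\<^sup>2 / 4)"
      using p w2 by (intro mult_mono) auto
    finally have "z powr (- l) * \<bar>Bessel_J \<nu> w\<bar> \<le> z powr (- l) * ((z powr l * (1 / 4) ^ k) * exp (M + (2 / a)\<^sup>2 / 4))"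
      by (intro mult_left_mono) auto
    also have "\<dots> = exp (M + (2 / a)\<^sup>2 / 4) * (1 / 4) ^ k"
      using z by (simp add: powr_minus field_simps)
    finally show "z powr (- l) * \<bar>Bessel_J (2 * (real k + l) / a) (2 / a * z powr (a / 2))\<bar>
        \<le> exp (M + (2 / a)\<^sup>2 / 4) * (1 / 4) ^ k"
      by (simp add: \<nu>_def w_def)
  qed
qed

lemma Gegenbauer_coeff_bound:
  assumes l: "l > 0"
  obtains B where "\<And>k \<theta>. \<bar>(l + real k) / l * Gegenbauer k l (cos \<theta>)\<bar> \<le> B * 2 ^ k"
proof (rule that)
  fix k \<theta>
  have "norm (complex_of_real ((l + real k) / l * Gegenbauer k l (cos \<theta>))) \<le> 2 * (1 / 4) powr (- l - 1) * 2 ^ k"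
  proof (rule power_series_coeff_le)
    fix t :: complex assume "norm t < 1"
    from sums_mult[OF Gegenbauer_generating_function[OF this, of l \<theta>], of "complex_of_real (1 / l)"]
    show "(\<lambda>k. complex_of_real ((l + real k) / l * Gegenbauer k l (cos \<theta>)) * t ^ k) sums
        ((1 - t\<^sup>2) * Gegenbauer_denom \<theta> t powr (- of_real l - 1))"
      using l by (simp add: mult.assoc)
  next
    fix t :: complex assume t: "norm t = 1 / 2"
    have "1 / 4 \<le> norm (Gegenbauer_denom \<theta> t)"
      using norm_Gegenbauer_denom_ge[of t \<theta>] unfolding t by (simp add: power2_eq_square)
    then show "norm ((1 - t\<^sup>2) * Gegenbauer_denom \<theta> t powr (- of_real l - 1)) \<le> 2 * (1 / 4) powr (- l - 1)"
      by (rule norm_Gegenbauer_generating_le) (use l t in auto)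
  qed
  then show "\<bar>(l + real k) / l * Gegenbauer k l (cos \<theta>)\<bar> \<le> 2 * (1 / 4) powr (- l - 1) * 2 ^ k"
    by (simp only: norm_of_real)
qed

lemma Gegenbauer_series_bounded_small:
  assumes a: "a > 0" and l: "l > 0"
  obtains C where "\<And>z \<theta>. 0 < z \<Longrightarrow> z \<le> 1 \<Longrightarrow>
     norm (\<Sum>k. exp (- (\<i> * complex_of_real (pi * real k / a))) *
        complex_of_real ((l + real k) / l * z powr (- l) *
           Bessel_J (2 * (real k + l) / a) (2 / a * z powr (a / 2)) * Gegenbauer k l (cos \<theta>))) \<le> C"
proof -
  obtain B where B: "\<And>k \<theta>. \<bar>(l + real k) / l * Gegenbauer k l (cos \<theta>)\<bar> \<le> B * 2 ^ k"
    using Gegenbauer_coeff_bound[OF l] by blast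
  obtain D where D: "\<And>k z. 0 < z \<Longrightarrow> z \<le> 1 \<Longrightarrow>
    z powr (- l) * \<bar>Bessel_J (2 * (real k + l) / a) (2 / a * z powr (a / 2))\<bar> \<le> D * (1 / 4) ^ k"
    using Bessel_J_scaled_small[OF a less_imp_le[OF l]] by blast
  show ?thesis
  proof (rule that)
    fix z \<theta> :: real assume z: "0 < z" "z \<le> 1"
    have "norm (exp (- (\<i> * complex_of_real (pi * real k / a))) *
        complex_of_real ((l + real k) / l * z powr (- l) *
           Bessel_J (2 * (real k + l) / a) (2 / a * z powr (a / 2)) * Gegenbauer k l (cos \<theta>)))
       \<le> B * D * (1 / 2) ^ k" for k
    proof -
      have "norm (exp (- (\<i> * complex_of_real (pi * real k / a))) *
          complex_of_real ((l + real k) / l * z powr (- l) *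
           Bessel_J (2 * (real k + l) / a) (2 / a * z powr (a / 2)) * Gegenbauer k l (cos \<theta>))) =
         \<bar>(l + real k) / l * Gegenbauer k l (cos \<theta>)\<bar> *
         (z powr (- l) * \<bar>Bessel_J (2 * (real k + l) / a) (2 / a * z powr (a / 2))\<bar>)"
        unfolding norm_mult[of "exp _"] norm_of_real by (simp add: abs_mult)
      also have "\<dots> \<le> (B * 2 ^ k) * (D * (1 / 4) ^ k)"
        by (rule mult_mono[OF B D[OF z] order_trans[OF abs_ge_zero B]]) simp
      also have "\<dots> = B * D * (2 * (1 / 4)) ^ k"
        unfolding power_mult_distrib by simp
      finally show ?thesis by simp
    qed
    then show "norm (\<Sum>k. exp (- (\<i> * complex_of_real (pi * real k / a))) *
        complex_of_real ((l + real k) / l * z powr (- l) *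
           Bessel_J (2 * (real k + l) / a) (2 / a * z powr (a / 2)) * Gegenbauer k l (cos \<theta>)))
       \<le> (\<Sum>k. B * D * (1 / 2) ^ k)"
      by (intro norm_suminf_le summable_mult summable_geometric) auto
  qed
qed

text \<open>
  In this form, with the constraint on the angle resolved, both parts of the final theorem are
  instances. In dimension at least 3 the cases \<open>z \<ge> 1\<close> and \<open>z \<le> 1\<close> are separate, because the contour
  estimate bounds the series without the factor \<open>z\<^sup>-\<^sup>l\<close>, which is harmless only for \<open>z \<ge> 1\<close>.
\<close>

lemma radial_kernel_bounded:
  fixes a \<delta> :: real
  assumes a: "a > 0" and n: "CARD('n::finite) \<ge> 2" and \<delta>: "0 < \<delta>" "\<delta> < pi"
  obtains C where "C > 0"
    "\<And>(x :: real ^ 'n) (y :: real ^ 'n) \<theta>. x \<bullet> y = norm x * norm y * cos \<theta> \<Longrightarrow>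
       2 * pi / a + \<delta> \<le> \<theta> \<Longrightarrow> \<theta> \<le> pi \<Longrightarrow> norm (radial_kernel a x y) \<le> C"
proof -
  have "\<exists>C. \<forall>(x :: real ^ 'n) (y :: real ^ 'n) \<theta>. x \<noteq> 0 \<longrightarrow> y \<noteq> 0 \<longrightarrow> x \<bullet> y = norm x * norm y * cos \<theta> \<longrightarrow>
       2 * pi / a + \<delta> \<le> \<theta> \<longrightarrow> \<theta> \<le> pi \<longrightarrow> norm (radial_kernel a x y) \<le> C"
  proof (cases "CARD('n) = 2")
    case True
    obtain C0 where C0: "\<And>w. w > 0 \<Longrightarrow> \<bar>Bessel_J 0 w\<bar> \<le> C0" using Bessel_J_0_bounded by blast
    obtain C1 where C1: "\<And>w \<theta>. w > 0 \<Longrightarrow> 2 * pi / a + \<delta> \<le> \<theta> \<Longrightarrow> \<theta> \<le> pi \<Longrightarrow>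
     norm (\<Sum>k. exp (- (\<i> * complex_of_real (pi * real (Suc k) / a))) *
        complex_of_real (Bessel_J (2 * real (Suc k) / a) w * cos (real (Suc k) * \<theta>))) \<le> C1"
      using planar_series_bounded[OF a \<delta>] by blast
    show ?thesis
    proof (intro exI[of _ "C0 + 2 * C1"] allI impI)
      fix x y :: "real ^ 'n" and \<theta>
      assume xy: "x \<noteq> 0" "y \<noteq> 0" "x \<bullet> y = norm x * norm y * cos \<theta>"
        and \<theta>: "2 * pi / a + \<delta> \<le> \<theta>" "\<theta> \<le> pi"
      define w where "w = 2 / a * (norm x * norm y) powr (a / 2)"
      have w: "w > 0" using a xy by (simp add: w_def)
      have "\<theta> \<ge> 0" using \<theta> \<delta> a by (smt (verit) divide_nonneg_pos pi_ge_zero)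
      moreover have "x \<bullet> y / (norm x * norm y) = cos \<theta>" using xy by simp
      ultimately have th: "arccos (x \<bullet> y / (norm x * norm y)) = \<theta>"
        using \<theta> by (simp add: arccos_cos)
      have "radial_kernel a x y = complex_of_real (Bessel_J 0 w) +
           2 * (\<Sum>k. exp (- (\<i> * complex_of_real (pi * real (Suc k) / a))) *
                  complex_of_real (Bessel_J (2 * real (Suc k) / a) w * cos (real (Suc k) * \<theta>)))"
        unfolding radial_kernel_def Let_def th w_def[symmetric] using xy True by simp
      also have "norm \<dots> \<le> C0 + 2 * C1"
      proof (rule order_trans[OF norm_triangle_ineq add_mono])
        show "norm (complex_of_real (Bessel_J 0 w)) \<le> C0"
          using C0[OF w] by simp
        show "norm (2 * (\<Sum>k. exp (- (\<i> * complex_of_real (pi * real (Suc k) / a))) *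
                  complex_of_real (Bessel_J (2 * real (Suc k) / a) w * cos (real (Suc k) * \<theta>)))) \<le> 2 * C1"
          unfolding norm_mult[of 2] norm_numeral by (rule mult_left_mono[OF C1[OF w \<theta>]]) simp
      qed
      finally show "norm (radial_kernel a x y) \<le> C0 + 2 * C1" .
    qed
  next
    case False
    define l where "l = (real CARD('n) - 2) / 2"
    have l: "l > 0" using n False by (simp add: l_def)
    define A where "A = \<bar>a powr (2 * l / a) * Gamma ((2 * l + a) / a)\<bar>"
    obtain C1 where C1: "\<And>w z \<theta>. w > 0 \<Longrightarrow> z \<ge> 1 \<Longrightarrow> 2 * pi / a + \<delta> \<le> \<theta> \<Longrightarrow> \<theta> \<le> pi \<Longrightarrow>
     norm (\<Sum>k. exp (- (\<i> * complex_of_real (pi * real k / a))) *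
        complex_of_real ((l + real k) / l * z powr (- l) *
           Bessel_J (2 * (real k + l) / a) w * Gegenbauer k l (cos \<theta>))) \<le> C1"
      using Gegenbauer_series_bounded_large[OF a \<delta> l] by blast
    obtain C2 where C2: "\<And>z \<theta>. 0 < z \<Longrightarrow> z \<le> 1 \<Longrightarrow>
     norm (\<Sum>k. exp (- (\<i> * complex_of_real (pi * real k / a))) *
        complex_of_real ((l + real k) / l * z powr (- l) *
           Bessel_J (2 * (real k + l) / a) (2 / a * z powr (a / 2)) * Gegenbauer k l (cos \<theta>))) \<le> C2"
      using Gegenbauer_series_bounded_small[OF a l] by blast
    show ?thesis
    proof (intro exI[of _ "A * max C1 C2"] allI impI)
      fix x y :: "real ^ 'n" and \<theta>
      assume xy: "x \<noteq> 0" "y \<noteq> 0" "x \<bullet> y = norm x * norm y * cos \<theta>"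
        and \<theta>: "2 * pi / a + \<delta> \<le> \<theta>" "\<theta> \<le> pi"
      define z where "z = norm x * norm y"
      have z: "z > 0" using xy by (simp add: z_def)
      define w where "w = 2 / a * z powr (a / 2)"
      have w: "w > 0" using a z by (simp add: w_def)
      have xi: "x \<bullet> y / z = cos \<theta>" using xy by (simp add: z_def)
      define S where "S = (\<Sum>k. exp (- (\<i> * complex_of_real (pi * real k / a))) *
        complex_of_real ((l + real k) / l * z powr (- l) *
           Bessel_J (2 * (real k + l) / a) w * Gegenbauer k l (cos \<theta>)))"
      have "radial_kernel a x y = complex_of_real (a powr (2 * l / a) * Gamma ((2 * l + a) / a)) * S"
        unfolding radial_kernel_def Let_def z_def[symmetric] xi w_def[symmetric] l_def[symmetric] S_def
        using xy False by simp
      then have "norm (radial_kernel a x y) = A * norm S"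
        by (simp only: norm_mult norm_of_real A_def)
      also have "norm S \<le> max C1 C2"
      proof (cases "z \<le> 1")
        case True
        then show ?thesis using C2[OF z, of \<theta>] by (simp only: S_def w_def le_max_iff_disj simp_thms)
      next
        case False
        then show ?thesis using C1[OF w _ \<theta>, of z] by (simp add: S_def le_max_iff_disj)
      qed
      then have "A * norm S \<le> A * max C1 C2" by (rule mult_left_mono) (simp add: A_def)
      finally show "norm (radial_kernel a x y) \<le> A * max C1 C2" .
    qed
  qed
  then obtain C where C: "\<And>(x :: real ^ 'n) (y :: real ^ 'n) \<theta>. x \<noteq> 0 \<Longrightarrow> y \<noteq> 0 \<Longrightarrow> x \<bullet> y = norm x * norm y * cos \<theta> \<Longrightarrow>
       2 * pi / a + \<delta> \<le> \<theta> \<Longrightarrow> \<theta> \<le> pi \<Longrightarrow> norm (radial_kernel a x y) \<le> C" by blast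
  show ?thesis
  proof (rule that[of "max 1 C"])
    fix x y :: "real ^ 'n" and \<theta>
    assume h: "x \<bullet> y = norm x * norm y * cos \<theta>" "2 * pi / a + \<delta> \<le> \<theta>" "\<theta> \<le> pi"
    show "norm (radial_kernel a x y) \<le> max 1 C"
    proof (cases "x = 0 \<or> y = 0")
      case True
      then show ?thesis by (auto simp: radial_kernel_def)
    next
      case False
      then show ?thesis using C[OF _ _ h] by (simp add: le_max_iff_disj)
    qed
  qed simp
qed

theorem theorem4p10:
  fixes a :: real
  assumes "a > 1" and "CARD('n::finite) \<ge> 2"
  shows "(\<forall>\<mu>. pi / a < \<mu> \<and> \<mu> < min pi (2 * pi / a) \<longrightarrow>
            (\<exists>C>0. \<forall>(x :: real ^ 'n) (y :: real ^ 'n) \<theta>.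
               0 \<le> \<theta> \<and> \<theta> \<le> pi \<and> x \<bullet> y = norm x * norm y * cos \<theta> \<and>
               (\<forall>s\<in>{1, - 1}. \<mu> \<le> \<bar>Arg (exp (\<i> * complex_of_real (s * \<theta> + pi / a)))\<bar> \<and>
                  \<bar>Arg (exp (\<i> * complex_of_real (s * \<theta> + pi / a)))\<bar> \<le> pi) \<longrightarrow>
               norm (radial_kernel a x y) \<le> C)) \<and>
         (a > 4 \<longrightarrow>
            (\<exists>C>0. \<forall>(x :: real ^ 'n) (y :: real ^ 'n). x \<bullet> y \<le> 0 \<longrightarrow>
               norm (radial_kernel a x y) \<le> C))"
proof (intro conjI allI impI)
  fix \<mu> assume \<mu>: "pi / a < \<mu> \<and> \<mu> < min pi (2 * pi / a)"
  have pia: "0 < pi / a" "pi / a < pi" using assms(1) by (auto simp: field_simps)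
  define \<delta> where "\<delta> = \<mu> - pi / a"
  have \<delta>: "0 < \<delta>" "\<delta> < pi" using \<mu> pia by (auto simp: \<delta>_def)
  obtain C where C: "C > 0" "\<And>(x :: real ^ 'n) (y :: real ^ 'n) \<theta>. x \<bullet> y = norm x * norm y * cos \<theta> \<Longrightarrow>
       2 * pi / a + \<delta> \<le> \<theta> \<Longrightarrow> \<theta> \<le> pi \<Longrightarrow> norm (radial_kernel a x y) \<le> C"
    using radial_kernel_bounded[of a \<delta>, OF _ assms(2) \<delta>] assms(1) by auto
  show "\<exists>C>0. \<forall>(x :: real ^ 'n) (y :: real ^ 'n) \<theta>.
               0 \<le> \<theta> \<and> \<theta> \<le> pi \<and> x \<bullet> y = norm x * norm y * cos \<theta> \<and>
               (\<forall>s\<in>{1, - 1}. \<mu> \<le> \<bar>Arg (exp (\<i> * complex_of_real (s * \<theta> + pi / a)))\<bar> \<and>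
                  \<bar>Arg (exp (\<i> * complex_of_real (s * \<theta> + pi / a)))\<bar> \<le> pi) \<longrightarrow>
               norm (radial_kernel a x y) \<le> C"
  proof (intro exI[of _ C] conjI allI impI, rule C(1))
    fix x y :: "real ^ 'n" and \<theta>
    assume h: "0 \<le> \<theta> \<and> \<theta> \<le> pi \<and> x \<bullet> y = norm x * norm y * cos \<theta> \<and>
               (\<forall>s\<in>{1, - 1}. \<mu> \<le> \<bar>Arg (exp (\<i> * complex_of_real (s * \<theta> + pi / a)))\<bar> \<and>
                  \<bar>Arg (exp (\<i> * complex_of_real (s * \<theta> + pi / a)))\<bar> \<le> pi)"
    \<comment> \<open>Since \<open>0 < \<pi>/a < \<pi>\<close>, the number \<open>\<pi>/a - \<theta>\<close> is its own principal argument; its modulus can reach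
      \<open>\<mu> > \<pi>/a\<close> only if \<open>\<theta> \<ge> \<pi>/a + \<mu>\<close>.\<close>
    have "Arg (exp (\<i> * complex_of_real (- 1 * \<theta> + pi / a))) = - 1 * \<theta> + pi / a"
      using h pia by (subst Arg_exp) auto
    then have "\<mu> \<le> \<bar>- \<theta> + pi / a\<bar>" using h by auto
    then have "2 * pi / a + \<delta> \<le> \<theta>" using h \<mu> by (auto simp: \<delta>_def)
    then show "norm (radial_kernel a x y) \<le> C" using h by (intro C(2)) auto
  qed
next
  assume a: "a > 4"
  \<comment> \<open>\<open>x \<bullet> y \<le> 0\<close> means \<open>\<theta> \<ge> \<pi>/2\<close>, and \<open>a > 4\<close> is exactly \<open>2\<pi>/a < \<pi>/2\<close>.\<close>
  define \<delta> where "\<delta> = pi / 2 - 2 * pi / a"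
  have "2 * pi / a < pi / 2" using a by (simp add: field_simps)
  moreover have "2 * pi / a > 0" using a by simp
  ultimately have \<delta>: "0 < \<delta>" "\<delta> < pi" by (auto simp: \<delta>_def)
  obtain C where C: "C > 0" "\<And>(x :: real ^ 'n) (y :: real ^ 'n) \<theta>. x \<bullet> y = norm x * norm y * cos \<theta> \<Longrightarrow>
       2 * pi / a + \<delta> \<le> \<theta> \<Longrightarrow> \<theta> \<le> pi \<Longrightarrow> norm (radial_kernel a x y) \<le> C"
    using radial_kernel_bounded[of a \<delta>, OF _ assms(2) \<delta>] assms(1) by auto
  show "\<exists>C>0. \<forall>(x :: real ^ 'n) (y :: real ^ 'n). x \<bullet> y \<le> 0 \<longrightarrow> norm (radial_kernel a x y) \<le> C"
  proof (intro exI[of _ C] conjI allI impI, rule C(1))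
    fix x y :: "real ^ 'n" assume xy: "x \<bullet> y \<le> 0"
    define \<theta> where "\<theta> = arccos (x \<bullet> y / (norm x * norm y))"
    have "\<bar>x \<bullet> y\<bar> \<le> norm x * norm y" by (rule Cauchy_Schwarz_ineq2)
    then have r: "- 1 \<le> x \<bullet> y / (norm x * norm y)" "x \<bullet> y / (norm x * norm y) \<le> 0"
      using xy by (auto simp: divide_simps abs_le_iff)
    have "x \<bullet> y = norm x * norm y * cos \<theta>"
      using r by (auto simp: \<theta>_def cos_arccos)
    moreover have "\<theta> \<ge> pi / 2"
      using arccos_le_mono[of 0 "x \<bullet> y / (norm x * norm y)"] r by (simp add: \<theta>_def)
    moreover have "\<theta> \<le> pi" using r by (simp add: \<theta>_def arccos_ubound)
    ultimately show "norm (radial_kernel a x y) \<le> C"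
      by (intro C(2)) (auto simp: \<delta>_def)
  qed
qed

end
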